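(* Let $I$ be a non-empty totally ordered set and let $A$ be a unital Banach algebra with $\Delta(A)\neq\emptyset$. Then $UP(I,A)$ is pseudo-contractible if and only if $I$ is a singleton and $A$ is pseudo-contractible.
   Context: $\Delta(A)$ denotes the character space of a Banach algebra $A$, i.e. the set of all non-zero multiplicative linear functionals on $A$. For a Banach algebra $A$ and a non-empty totally ordered set $I$, $UP(I,A)$ is the set of all $I\times I$ upper triangular matrices $(a_{i,j})_{i,j\in I}$ with entries in $A$ (so $a_{i,j}=0$ unless $i\le j$) such that $\|(a_{i,j})\|=\sum_{i,j\in I}\|a_{i,j}\|<\infty$. With the usual matrix operations and this norm, $UP(I,A)$ is a Banach algebra. The projective tensor product $B\otimes_p B$ of a Banach algebra $B$ with itself is a Banach $B$-bimodule via $a\cdot(b\otimes c)=ab\otimes c$ and $(b\otimes c)\cdot a=b\otimes ca$, and $\pi_B:B\otimes_p B\to B$ is the bounded linear map determined by $\pi_B(a\otimes b)=ab$. A Banach algebra $B$ is pseudo-contractible if there exists a (not necessarily bounded) net $(m_\alpha)$ in $B\otimes_p B$ such that $a\cdot m_\alpha=m_\alpha\cdot a$ for all $\alpha$ and $\pi_B(m_\alpha)a\to a$, for every $a\in B$. *)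

theory Defs
  imports "HOL-Analysis.Analysis" "HOL-Library.Multiset"
begin

section \<open>Complex Banach spaces and Banach algebras\<close>

class scaleC =
  fixes scaleC :: "complex \<Rightarrow> 'a \<Rightarrow> 'a"  (infixr \<open>*\<^sub>C\<close> 75)

class complex_vector = real_vector + scaleC +
  assumes scaleC_add_right: "c *\<^sub>C (x + y) = c *\<^sub>C x + c *\<^sub>C y"
    and scaleC_add_left: "(c + d) *\<^sub>C x = c *\<^sub>C x + d *\<^sub>C x"
    and scaleC_scaleC: "c *\<^sub>C (d *\<^sub>C x) = (c * d) *\<^sub>C x"
    and scaleR_scaleC: "r *\<^sub>R x = complex_of_real r *\<^sub>C x"

class complex_banach = complex_vector + banach +
  assumes norm_scaleC: "norm (c *\<^sub>C x) = cmod c * norm x"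

text \<open>A Banach algebra need not have a unit.\<close>

class complex_banach_algebra = complex_banach + real_normed_algebra +
  assumes mult_scaleC_left: "(c *\<^sub>C x) * y = c *\<^sub>C (x * y)"
    and mult_scaleC_right: "x * (c *\<^sub>C y) = c *\<^sub>C (x * y)"

instantiation complex :: complex_banach_algebra
begin

definition scaleC_complex :: "complex \<Rightarrow> complex \<Rightarrow> complex"
  where "scaleC_complex c z = c * z"

instance
  by intro_classes (simp_all add: scaleC_complex_def algebra_simps scaleR_conv_of_real norm_mult)

end

lemma scaleC_one [simp]: "1 *\<^sub>C x = (x :: 'a::complex_vector)"
  using scaleR_scaleC[of 1 x] by simp

lemma scaleC_zero_left [simp]: "0 *\<^sub>C x = (0 :: 'a::complex_vector)"
  using scaleR_scaleC[of 0 x] by simp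

lemma scaleC_zero_right [simp]: "c *\<^sub>C 0 = (0 :: 'a::complex_vector)"
  using scaleC_add_right[of c 0 0] by simp

lemma scaleC_minus_one: "(-1) *\<^sub>C x = - (x :: 'a::complex_vector)"
  using scaleR_scaleC[of "-1" x] by simp

lemma scaleC_minus_right: "c *\<^sub>C (- x) = - (c *\<^sub>C (x :: 'a::complex_vector))"
  using scaleC_add_right[of c x "- x"] by (simp add: eq_neg_iff_add_eq_0 add.commute)

lemma scaleC_diff_right: "c *\<^sub>C (x - y) = c *\<^sub>C x - c *\<^sub>C (y :: 'a::complex_vector)"
  using scaleC_add_right[of c x "- y"] by (simp add: scaleC_minus_right)

lemma bounded_linear_scaleC: "bounded_linear (\<lambda>x :: 'a::complex_banach. c *\<^sub>C x)"
  by (rule bounded_linear_intro[where K = "cmod c"])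
    (simp_all add: scaleC_add_right scaleR_scaleC scaleC_scaleC norm_scaleC mult.commute)

definition clinear :: "('a::complex_vector \<Rightarrow> 'b::complex_vector) \<Rightarrow> bool"
  where "clinear f \<longleftrightarrow> (\<forall>x y. f (x + y) = f x + f y) \<and> (\<forall>c x. f (c *\<^sub>C x) = c *\<^sub>C f x)"

definition bounded_clinear :: "('a::complex_banach \<Rightarrow> 'b::complex_banach) \<Rightarrow> bool"
  where "bounded_clinear f \<longleftrightarrow> clinear f \<and> (\<exists>K. \<forall>x. norm (f x) \<le> K * norm x)"

definition cbilinear ::
    "('a::complex_vector \<Rightarrow> 'b::complex_vector \<Rightarrow> 'c::complex_vector) \<Rightarrow> bool"
  where "cbilinear T \<longleftrightarrow> (\<forall>y. clinear (\<lambda>x. T x y)) \<and> (\<forall>x. clinear (T x))"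

definition bounded_cbilinear ::
    "('a::complex_banach \<Rightarrow> 'b::complex_banach \<Rightarrow> 'c::complex_banach) \<Rightarrow> bool"
  where "bounded_cbilinear T \<longleftrightarrow>
    cbilinear T \<and> (\<exists>K. \<forall>x y. norm (T x y) \<le> K * (norm x * norm y))"

lemma clinear_zero: "clinear f \<Longrightarrow> f 0 = 0"
  unfolding clinear_def by (metis scaleC_zero_left)

lemma clinear_diff: "clinear f \<Longrightarrow> f (x - y) = f x - f y"
  by (metis add_diff_cancel_right' clinear_def diff_add_cancel)

lemma bounded_clinear_imp_bounded_linear: "bounded_clinear f \<Longrightarrow> bounded_linear f"
  unfolding bounded_clinear_def clinear_def
  by (metis bounded_linear_intro mult.commute scaleR_scaleC)

lemma bounded_cbilinear_mult:
  "bounded_cbilinear ((*) :: 'a::complex_banach_algebra \<Rightarrow> 'a \<Rightarrow> 'a)"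
  unfolding bounded_cbilinear_def cbilinear_def clinear_def
  by (auto simp: algebra_simps mult_scaleC_left mult_scaleC_right intro!: exI[of _ 1] norm_mult_ineq)


section \<open>The algebraic tensor product\<close>

text \<open>
  A multiset of pairs $(x_i, y_i)$ stands for the formal finite sum $\sum_i x_i \otimes y_i$.
  Two formal sums are identified by the congruence generated by the bilinearity relations.
  The last rule is needed because the empty sum is not otherwise related to anything else.
\<close>

inductive tensor_eq ::
    "('a::complex_vector \<times> 'b::complex_vector) multiset \<Rightarrow> ('a \<times> 'b) multiset \<Rightarrow> bool" where
  refl: "tensor_eq M M"
| sym: "tensor_eq M N \<Longrightarrow> tensor_eq N M"
| trans: "tensor_eq M N \<Longrightarrow> tensor_eq N P \<Longrightarrow> tensor_eq M P"
| add: "tensor_eq M M' \<Longrightarrow> tensor_eq N N' \<Longrightarrow> tensor_eq (M + N) (M' + N')"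
| add_left: "tensor_eq {#(x + x', y)#} {#(x, y), (x', y)#}"
| add_right: "tensor_eq {#(x, y + y')#} {#(x, y), (x, y')#}"
| scale: "tensor_eq {#(c *\<^sub>C x, y)#} {#(x, c *\<^sub>C y)#}"
| zero: "tensor_eq {#(0, y)#} {#}"

quotient_type (overloaded) ('a, 'b) alg_tensor =
  "('a::complex_vector \<times> 'b::complex_vector) multiset" / tensor_eq
  by (rule equivpI)
    (auto intro!: reflpI sympI transpI intro: tensor_eq.refl tensor_eq.sym tensor_eq.trans)

text \<open>The scalar acts on the first tensor factor.\<close>

definition mset_scale :: "complex \<Rightarrow> ('a::complex_vector \<times> 'b) multiset \<Rightarrow> ('a \<times> 'b) multiset"
  where "mset_scale c M = image_mset (\<lambda>(x, y). (c *\<^sub>C x, y)) M"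

lemma mset_scale_simps [simp]:
  "mset_scale c {#} = {#}"
  "mset_scale c (add_mset (x, y) M) = add_mset (c *\<^sub>C x, y) (mset_scale c M)"
  "mset_scale c (M + N) = mset_scale c M + mset_scale c N"
  by (simp_all add: mset_scale_def)

lemma tensor_eq_mset_scale:
  "tensor_eq M N \<Longrightarrow> tensor_eq (mset_scale c M) (mset_scale c N)"
proof (induction rule: tensor_eq.induct)
  case (scale d x y)
  then show ?case
    using tensor_eq.scale[of d "c *\<^sub>C x" y] by (simp add: scaleC_scaleC mult.commute)
qed (auto simp: scaleC_add_right
      intro: tensor_eq.refl tensor_eq.sym tensor_eq.trans tensor_eq.add tensor_eq.add_left
        tensor_eq.add_right tensor_eq.zero)

lemma tensor_eq_scale_add:
  "tensor_eq (mset_scale (c + d) M) (mset_scale c M + mset_scale d M)"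
proof (induction M)
  case empty
  then show ?case by (simp add: tensor_eq.refl)
next
  case (add p M)
  obtain x y where p: "p = (x, y)" by (cases p)
  have "tensor_eq ({#((c + d) *\<^sub>C x, y)#} + mset_scale (c + d) M)
      ({#(c *\<^sub>C x, y), (d *\<^sub>C x, y)#} + (mset_scale c M + mset_scale d M))"
    by (intro tensor_eq.add add) (simp add: scaleC_add_left tensor_eq.add_left)
  then show ?case by (simp add: p add_mset_commute)
qed

lemma tensor_eq_scale_0: "tensor_eq (mset_scale 0 M) {#}"
proof (induction M)
  case empty
  then show ?case by (simp add: tensor_eq.refl)
next
  case (add p M)
  obtain x y where p: "p = (x, y)" by (cases p)
  have "tensor_eq ({#(0, y)#} + mset_scale 0 M) ({#} + {#})"
    by (intro tensor_eq.add add tensor_eq.zero)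
  then show ?case by (simp add: p)
qed

lemma mset_scale_mset_scale: "mset_scale c (mset_scale d M) = mset_scale (c * d) M"
  unfolding mset_scale_def by (simp add: multiset.map_comp o_def case_prod_unfold scaleC_scaleC)

lemma mset_scale_1: "mset_scale 1 M = M"
  unfolding mset_scale_def by simp

instantiation alg_tensor :: (complex_vector, complex_vector) complex_vector
begin

lift_definition zero_alg_tensor :: "('a, 'b) alg_tensor" is "{#}" .

lift_definition plus_alg_tensor ::
    "('a, 'b) alg_tensor \<Rightarrow> ('a, 'b) alg_tensor \<Rightarrow> ('a, 'b) alg_tensor" is "(+)"
  by (rule tensor_eq.add)

lift_definition scaleC_alg_tensor :: "complex \<Rightarrow> ('a, 'b) alg_tensor \<Rightarrow> ('a, 'b) alg_tensor"
  is mset_scale by (rule tensor_eq_mset_scale)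

definition scaleR_alg_tensor :: "real \<Rightarrow> ('a, 'b) alg_tensor \<Rightarrow> ('a, 'b) alg_tensor"
  where "scaleR_alg_tensor r u = complex_of_real r *\<^sub>C u"

definition uminus_alg_tensor :: "('a, 'b) alg_tensor \<Rightarrow> ('a, 'b) alg_tensor"
  where "uminus_alg_tensor u = (-1) *\<^sub>C u"

definition minus_alg_tensor :: "('a, 'b) alg_tensor \<Rightarrow> ('a, 'b) alg_tensor \<Rightarrow> ('a, 'b) alg_tensor"
  where "minus_alg_tensor u v = u + (- v)"

instance
proof
  fix u v w :: "('a, 'b) alg_tensor" and c d :: complex and r s :: real
  show "u + v + w = u + (v + w)"
    by transfer (simp add: add.assoc tensor_eq.refl)
  show comm: "u + v = v + u"
    by transfer (simp add: add.commute tensor_eq.refl)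
  show "0 + u = u"
    by transfer (simp add: tensor_eq.refl)
  show addr: "c *\<^sub>C (u + v) = c *\<^sub>C u + c *\<^sub>C v" for c u and v :: "('a, 'b) alg_tensor"
    by transfer (simp add: tensor_eq.refl)
  show addl: "(c + d) *\<^sub>C u = c *\<^sub>C u + d *\<^sub>C u" for c d and u :: "('a, 'b) alg_tensor"
    by transfer (rule tensor_eq_scale_add)
  show sc: "c *\<^sub>C d *\<^sub>C u = (c * d) *\<^sub>C u" for c d and u :: "('a, 'b) alg_tensor"
    by transfer (simp add: mset_scale_mset_scale tensor_eq.refl)
  have one: "1 *\<^sub>C u = u" for u :: "('a, 'b) alg_tensor"
    by transfer (simp add: mset_scale_1 tensor_eq.refl)
  have zero: "0 *\<^sub>C u = 0" for u :: "('a, 'b) alg_tensor"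
    by transfer (rule tensor_eq_scale_0)
  show "- u + u = 0"
    using addl[of "-1" 1 u] by (simp add: uminus_alg_tensor_def one zero)
  show "u - v = u + - v" by (rule minus_alg_tensor_def)
  show "r *\<^sub>R u = complex_of_real r *\<^sub>C u" by (rule scaleR_alg_tensor_def)
  show "r *\<^sub>R (u + v) = r *\<^sub>R u + r *\<^sub>R v"
    by (simp add: scaleR_alg_tensor_def addr)
  show "(r + s) *\<^sub>R u = r *\<^sub>R u + s *\<^sub>R u"
    by (simp add: scaleR_alg_tensor_def addl)
  show "r *\<^sub>R s *\<^sub>R u = (r * s) *\<^sub>R u"
    by (simp add: scaleR_alg_tensor_def sc)
  show "1 *\<^sub>R u = u"
    by (simp add: scaleR_alg_tensor_def one)
qed

end

lift_definition alg_pure :: "'a::complex_vector \<Rightarrow> 'b::complex_vector \<Rightarrow> ('a, 'b) alg_tensor"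
  is "\<lambda>x y. {#(x, y)#}" .

lemma abs_alg_tensor_simps:
  "abs_alg_tensor {#} = 0"
  "abs_alg_tensor (M + N) = abs_alg_tensor M + abs_alg_tensor N"
  "abs_alg_tensor (mset_scale c M) = c *\<^sub>C abs_alg_tensor M"
  "abs_alg_tensor {#(x, y)#} = alg_pure x y"
  by (simp_all add: zero_alg_tensor_def plus_alg_tensor.abs_eq scaleC_alg_tensor.abs_eq
      alg_pure.abs_eq)

lemma alg_tensor_cases: obtains M where "u = abs_alg_tensor M"
  by (metis Quotient3_abs_rep Quotient3_alg_tensor)

lemma cbilinear_alg_pure: "cbilinear (alg_pure :: 'a::complex_vector \<Rightarrow> 'b::complex_vector \<Rightarrow> _)"
proof -
  have "alg_pure (x + x') y = alg_pure x y + alg_pure x' y" for x x' :: 'a and y :: 'b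
    by transfer (use tensor_eq.add_left in \<open>simp add: add_mset_commute\<close>)
  moreover have "alg_pure x (y + y') = alg_pure x y + alg_pure x y'" for x :: 'a and y y' :: 'b
    by transfer (use tensor_eq.add_right in \<open>simp add: add_mset_commute\<close>)
  moreover have "alg_pure (c *\<^sub>C x) y = c *\<^sub>C alg_pure x y" for c and x :: 'a and y :: 'b
    by transfer (simp add: tensor_eq.refl)
  moreover have "alg_pure x (c *\<^sub>C y) = c *\<^sub>C alg_pure x y" for c and x :: 'a and y :: 'b
    by transfer (simp add: tensor_eq.scale tensor_eq.sym)
  ultimately show ?thesis by (simp add: cbilinear_def clinear_def)
qed

subsection \<open>The projective seminorm\<close>

definition mset_cost :: "('a::complex_banach \<times> 'b::complex_banach) multiset \<Rightarrow> real"
  where "mset_cost M = (\<Sum>(x, y)\<in>#M. norm x * norm y)"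

text \<open>
  $\|u\|_p = \inf \{\sum_i \|x_i\|\,\|y_i\| : u = \sum_i x_i \otimes y_i\}$.
\<close>

definition proj_norm :: "('a::complex_banach, 'b::complex_banach) alg_tensor \<Rightarrow> real"
  where "proj_norm u = Inf {mset_cost M |M. abs_alg_tensor M = u}"

lemma mset_cost_simps [simp]:
  "mset_cost {#} = 0"
  "mset_cost (add_mset (x, y) M) = norm x * norm y + mset_cost M"
  "mset_cost (M + N) = mset_cost M + mset_cost N"
  by (simp_all add: mset_cost_def)

lemma mset_cost_nonneg: "0 \<le> mset_cost M"
  by (induction M) auto

lemma mset_cost_scale: "mset_cost (mset_scale c M) = cmod c * mset_cost M"
  by (induction M) (auto simp: norm_scaleC algebra_simps)

lemma proj_norm_le: "proj_norm (abs_alg_tensor M) \<le> mset_cost M"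
  unfolding proj_norm_def
  by (rule cInf_lower) (auto intro!: bdd_belowI[of _ 0] mset_cost_nonneg)

lemma proj_norm_lessE:
  assumes "proj_norm u < e"
  obtains M where "u = abs_alg_tensor M" "mset_cost M < e"
proof -
  have "{mset_cost M |M. abs_alg_tensor M = u} \<noteq> {}"
    by (cases u rule: alg_tensor_cases) auto
  then have "\<exists>c\<in>{mset_cost M |M. abs_alg_tensor M = u}. c < e"
    using assms unfolding proj_norm_def
    by (subst (asm) cInf_less_iff) (auto intro!: bdd_belowI[of _ 0] mset_cost_nonneg)
  then show ?thesis using that by blast
qed

lemma proj_norm_nonneg: "0 \<le> proj_norm u"
proof (rule ccontr)
  assume "\<not> 0 \<le> proj_norm u"
  then show False
    by (metis mset_cost_nonneg not_le proj_norm_lessE)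
qed

lemma proj_norm_0 [simp]: "proj_norm 0 = 0"
  by (rule antisym) (use proj_norm_le[of "{#}"] in \<open>simp_all add: abs_alg_tensor_simps proj_norm_nonneg\<close>)

lemma proj_norm_add: "proj_norm (u + v) \<le> proj_norm u + proj_norm v"
proof (rule field_le_epsilon)
  fix e :: real assume e: "e > 0"
  obtain M where M: "u = abs_alg_tensor M" "mset_cost M < proj_norm u + e / 2"
    using proj_norm_lessE[of u "proj_norm u + e / 2"] e by auto
  obtain N where N: "v = abs_alg_tensor N" "mset_cost N < proj_norm v + e / 2"
    using proj_norm_lessE[of v "proj_norm v + e / 2"] e by auto
  show "proj_norm (u + v) \<le> proj_norm u + proj_norm v + e"
    using proj_norm_le[of "M + N"] M N by (simp add: abs_alg_tensor_simps)
qed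

lemma proj_norm_scaleC_le: "proj_norm (c *\<^sub>C u) \<le> cmod c * proj_norm u"
proof (rule field_le_epsilon)
  fix e :: real assume e: "e > 0"
  have pos: "0 < cmod c + 1" by (simp add: add_nonneg_pos)
  obtain M where M: "u = abs_alg_tensor M" "mset_cost M < proj_norm u + e / (cmod c + 1)"
    using proj_norm_lessE[of u "proj_norm u + e / (cmod c + 1)"] e pos by auto
  have "proj_norm (c *\<^sub>C u) \<le> cmod c * mset_cost M"
    using proj_norm_le[of "mset_scale c M"] M by (simp add: abs_alg_tensor_simps mset_cost_scale)
  also have "\<dots> \<le> cmod c * (proj_norm u + e / (cmod c + 1))"
    using M by (intro mult_left_mono) auto
  also have "\<dots> \<le> cmod c * proj_norm u + e"
  proof -
    have "cmod c * (e / (cmod c + 1)) \<le> e"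
      using pos e by (simp add: field_simps)
    then show ?thesis by (simp add: distrib_left)
  qed
  finally show "proj_norm (c *\<^sub>C u) \<le> cmod c * proj_norm u + e" .
qed

lemma proj_norm_scaleC: "proj_norm (c *\<^sub>C u) = cmod c * proj_norm u"
proof (cases "c = 0")
  case False
  have "proj_norm u = proj_norm (inverse c *\<^sub>C (c *\<^sub>C u))"
    using False by (simp add: scaleC_scaleC)
  also have "\<dots> \<le> cmod (inverse c) * proj_norm (c *\<^sub>C u)"
    by (rule proj_norm_scaleC_le)
  finally have "cmod c * proj_norm u \<le> cmod c * (cmod (inverse c) * proj_norm (c *\<^sub>C u))"
    by (rule mult_left_mono) simp
  also have "\<dots> = proj_norm (c *\<^sub>C u)"
    using False by (simp flip: mult.assoc norm_mult)
  finally have "cmod c * proj_norm u \<le> proj_norm (c *\<^sub>C u)" .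
  then show ?thesis using proj_norm_scaleC_le[of c u] by simp
qed simp

lemma proj_norm_uminus: "proj_norm (- u) = proj_norm u"
  using proj_norm_scaleC[of "-1" u] by (simp add: scaleC_minus_one)

lemma proj_norm_minus_commute: "proj_norm (u - v) = proj_norm (v - u)"
  using proj_norm_uminus[of "u - v"] by simp

lemma proj_norm_triangle: "proj_norm (u - w) \<le> proj_norm (u - v) + proj_norm (v - w)"
  using proj_norm_add[of "u - v" "v - w"] by simp

lemma proj_norm_diff_le: "\<bar>proj_norm u - proj_norm v\<bar> \<le> proj_norm (u - v)"
  using proj_norm_add[of "u - v" v] proj_norm_add[of "v - u" u] proj_norm_minus_commute[of u v]
  by simp

lemma proj_norm_alg_pure_le: "proj_norm (alg_pure x y) \<le> norm x * norm y"
  using proj_norm_le[of "{#(x, y)#}"] by (simp add: abs_alg_tensor_simps)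


section \<open>The projective tensor product\<close>

text \<open>
  The completion of the algebraic tensor product under the projective norm, as Cauchy sequences
  modulo null sequences.
\<close>

definition pcauchy :: "(nat \<Rightarrow> ('a::complex_banach, 'b::complex_banach) alg_tensor) \<Rightarrow> bool"
  where "pcauchy X \<longleftrightarrow> (\<forall>e>0. \<exists>N. \<forall>m\<ge>N. \<forall>n\<ge>N. proj_norm (X m - X n) < e)"

definition ptensor_eq ::
    "(nat \<Rightarrow> ('a::complex_banach, 'b::complex_banach) alg_tensor) \<Rightarrow>
      (nat \<Rightarrow> ('a, 'b) alg_tensor) \<Rightarrow> bool"
  where "ptensor_eq X Y \<longleftrightarrow>
    pcauchy X \<and> pcauchy Y \<and> (\<lambda>n. proj_norm (X n - Y n)) \<longlonglongrightarrow> 0"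

lemma pcauchy_const: "pcauchy (\<lambda>_. u)"
  by (simp add: pcauchy_def)

lemma tendsto_0_proj_norm_le:
  assumes "g \<longlonglongrightarrow> 0" "\<And>n. proj_norm (X n) \<le> g n"
  shows "(\<lambda>n. proj_norm (X n)) \<longlonglongrightarrow> 0"
  by (rule tendsto_sandwich[OF _ _ tendsto_const assms(1)])
    (use assms(2) in \<open>simp_all add: proj_norm_nonneg\<close>)

lemma pcauchy_add:
  assumes "pcauchy X" "pcauchy Y"
  shows "pcauchy (\<lambda>n. X n + Y n)"
  unfolding pcauchy_def
proof (intro allI impI)
  fix e :: real assume e: "e > 0"
  obtain N1 where N1: "\<And>m n. m \<ge> N1 \<Longrightarrow> n \<ge> N1 \<Longrightarrow> proj_norm (X m - X n) < e / 2"
    using assms(1) e unfolding pcauchy_def by (meson half_gt_zero)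
  obtain N2 where N2: "\<And>m n. m \<ge> N2 \<Longrightarrow> n \<ge> N2 \<Longrightarrow> proj_norm (Y m - Y n) < e / 2"
    using assms(2) e unfolding pcauchy_def by (meson half_gt_zero)
  show "\<exists>N. \<forall>m\<ge>N. \<forall>n\<ge>N. proj_norm (X m + Y m - (X n + Y n)) < e"
  proof (intro exI allI impI)
    fix m n assume "m \<ge> max N1 N2" "n \<ge> max N1 N2"
    then have "proj_norm (X m - X n) + proj_norm (Y m - Y n) < e"
      using N1[of m n] N2[of m n] by simp
    then show "proj_norm (X m + Y m - (X n + Y n)) < e"
      using proj_norm_add[of "X m - X n" "Y m - Y n"] by (simp add: algebra_simps)
  qed
qed

lemma pcauchy_scaleC:
  assumes "pcauchy X"
  shows "pcauchy (\<lambda>n. c *\<^sub>C X n)"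
  unfolding pcauchy_def
proof (intro allI impI)
  fix e :: real assume e: "e > 0"
  have pos: "0 < cmod c + 1" by (simp add: add_nonneg_pos)
  then obtain N where N: "\<And>m n. m \<ge> N \<Longrightarrow> n \<ge> N \<Longrightarrow> proj_norm (X m - X n) < e / (cmod c + 1)"
    using assms e unfolding pcauchy_def by (meson divide_pos_pos)
  show "\<exists>N. \<forall>m\<ge>N. \<forall>n\<ge>N. proj_norm (c *\<^sub>C X m - c *\<^sub>C X n) < e"
  proof (intro exI allI impI)
    fix m n assume "m \<ge> N" "n \<ge> N"
    then have "(cmod c + 1) * proj_norm (X m - X n) < e"
      using N[of m n] pos by (simp add: field_simps)
    then show "proj_norm (c *\<^sub>C X m - c *\<^sub>C X n) < e"
      using proj_norm_nonneg[of "X m - X n"]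
      by (simp add: scaleC_diff_right[symmetric] proj_norm_scaleC distrib_right)
  qed
qed

lemma ptensor_eq_sym: "ptensor_eq X Y \<Longrightarrow> ptensor_eq Y X"
  by (simp add: ptensor_eq_def proj_norm_minus_commute)

lemma ptensor_eq_trans:
  assumes "ptensor_eq X Y" "ptensor_eq Y Z"
  shows "ptensor_eq X Z"
proof -
  have "(\<lambda>n. proj_norm (X n - Y n) + proj_norm (Y n - Z n)) \<longlonglongrightarrow> 0 + 0"
    by (intro tendsto_add) (use assms in \<open>auto simp: ptensor_eq_def\<close>)
  then have "(\<lambda>n. proj_norm (X n - Z n)) \<longlonglongrightarrow> 0"
    by (intro tendsto_0_proj_norm_le[of "\<lambda>n. proj_norm (X n - Y n) + proj_norm (Y n - Z n)"])
      (simp_all add: proj_norm_triangle)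
  then show ?thesis using assms by (simp add: ptensor_eq_def)
qed

lemma ptensor_eq_refl: "pcauchy X \<Longrightarrow> ptensor_eq X X"
  by (simp add: ptensor_eq_def)

lemma ptensor_eq_add:
  assumes "ptensor_eq X X'" "ptensor_eq Y Y'"
  shows "ptensor_eq (\<lambda>n. X n + Y n) (\<lambda>n. X' n + Y' n)"
proof -
  have "(\<lambda>n. proj_norm (X n - X' n) + proj_norm (Y n - Y' n)) \<longlonglongrightarrow> 0 + 0"
    by (intro tendsto_add) (use assms in \<open>auto simp: ptensor_eq_def\<close>)
  then have "(\<lambda>n. proj_norm (X n + Y n - (X' n + Y' n))) \<longlonglongrightarrow> 0"
    by (intro tendsto_0_proj_norm_le[of "\<lambda>n. proj_norm (X n - X' n) + proj_norm (Y n - Y' n)"])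
      (simp_all add: add_diff_add proj_norm_add)
  then show ?thesis using assms by (simp add: ptensor_eq_def pcauchy_add)
qed

lemma ptensor_eq_scaleC:
  assumes "ptensor_eq X X'"
  shows "ptensor_eq (\<lambda>n. c *\<^sub>C X n) (\<lambda>n. c *\<^sub>C X' n)"
proof -
  have "(\<lambda>n. cmod c * proj_norm (X n - X' n)) \<longlonglongrightarrow> cmod c * 0"
    by (intro tendsto_mult tendsto_const) (use assms in \<open>auto simp: ptensor_eq_def\<close>)
  then show ?thesis using assms
    by (simp add: ptensor_eq_def pcauchy_scaleC scaleC_diff_right[symmetric] proj_norm_scaleC)
qed

lemma pcauchy_proj_norm_convergent: "pcauchy X \<Longrightarrow> convergent (\<lambda>n. proj_norm (X n))"
  unfolding Cauchy_convergent_iff[symmetric]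
proof (rule metric_CauchyI)
  fix e :: real assume "pcauchy X" "e > 0"
  then obtain N where "\<And>m n. m \<ge> N \<Longrightarrow> n \<ge> N \<Longrightarrow> proj_norm (X m - X n) < e"
    unfolding pcauchy_def by meson
  then show "\<exists>N. \<forall>m\<ge>N. \<forall>n\<ge>N. dist (proj_norm (X m)) (proj_norm (X n)) < e"
    unfolding dist_real_def using proj_norm_diff_le le_less_trans by blast
qed

quotient_type (overloaded) ('a, 'b) proj_tensor =
  "nat \<Rightarrow> ('a::complex_banach, 'b::complex_banach) alg_tensor" / partial: ptensor_eq
proof (rule part_equivpI)
  show "\<exists>x. ptensor_eq x x" using ptensor_eq_refl pcauchy_const by blast
qed (auto intro!: sympI transpI intro: ptensor_eq_sym ptensor_eq_trans)

instantiation proj_tensor :: (complex_banach, complex_banach) complex_vector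
begin

lift_definition zero_proj_tensor :: "('a, 'b) proj_tensor" is "\<lambda>_. 0"
  by (simp add: ptensor_eq_refl pcauchy_const)

lift_definition plus_proj_tensor ::
    "('a, 'b) proj_tensor \<Rightarrow> ('a, 'b) proj_tensor \<Rightarrow> ('a, 'b) proj_tensor"
  is "\<lambda>X Y n. X n + Y n" by (rule ptensor_eq_add)

lift_definition scaleC_proj_tensor :: "complex \<Rightarrow> ('a, 'b) proj_tensor \<Rightarrow> ('a, 'b) proj_tensor"
  is "\<lambda>c X n. c *\<^sub>C X n" by (rule ptensor_eq_scaleC)

definition scaleR_proj_tensor :: "real \<Rightarrow> ('a, 'b) proj_tensor \<Rightarrow> ('a, 'b) proj_tensor"
  where "scaleR_proj_tensor r u = complex_of_real r *\<^sub>C u"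

definition uminus_proj_tensor :: "('a, 'b) proj_tensor \<Rightarrow> ('a, 'b) proj_tensor"
  where "uminus_proj_tensor u = (-1) *\<^sub>C u"

definition minus_proj_tensor ::
    "('a, 'b) proj_tensor \<Rightarrow> ('a, 'b) proj_tensor \<Rightarrow> ('a, 'b) proj_tensor"
  where "minus_proj_tensor u v = u + (- v)"

instance
proof
  fix u v w :: "('a, 'b) proj_tensor" and c d :: complex and r s :: real
  show "u + v + w = u + (v + w)"
    by transfer (simp add: ptensor_eq_def add.assoc pcauchy_add)
  show "u + v = v + u"
    by transfer (simp add: ptensor_eq_def add.commute pcauchy_add)
  show "0 + u = u"
    by transfer (simp add: ptensor_eq_def)
  show addr: "c *\<^sub>C (u + v) = c *\<^sub>C u + c *\<^sub>C v" for c u and v :: "('a, 'b) proj_tensor"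
    by transfer (simp add: ptensor_eq_def scaleC_add_right pcauchy_add pcauchy_scaleC)
  show addl: "(c + d) *\<^sub>C u = c *\<^sub>C u + d *\<^sub>C u" for c d and u :: "('a, 'b) proj_tensor"
    by transfer (simp add: ptensor_eq_def scaleC_add_left pcauchy_add pcauchy_scaleC)
  show sc: "c *\<^sub>C d *\<^sub>C u = (c * d) *\<^sub>C u" for c d and u :: "('a, 'b) proj_tensor"
    by transfer (simp add: ptensor_eq_def scaleC_scaleC pcauchy_scaleC)
  have one: "1 *\<^sub>C u = u" for u :: "('a, 'b) proj_tensor"
    by transfer (simp add: ptensor_eq_def)
  have zero: "0 *\<^sub>C u = 0" for u :: "('a, 'b) proj_tensor"
    by transfer (simp add: ptensor_eq_def pcauchy_const)
  show "- u + u = 0"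
    using addl[of "-1" 1 u] by (simp add: uminus_proj_tensor_def one zero)
  show "u - v = u + - v" by (rule minus_proj_tensor_def)
  show "r *\<^sub>R u = complex_of_real r *\<^sub>C u" by (rule scaleR_proj_tensor_def)
  show "r *\<^sub>R (u + v) = r *\<^sub>R u + r *\<^sub>R v"
    by (simp add: scaleR_proj_tensor_def addr)
  show "(r + s) *\<^sub>R u = r *\<^sub>R u + s *\<^sub>R u"
    by (simp add: scaleR_proj_tensor_def addl)
  show "r *\<^sub>R s *\<^sub>R u = (r * s) *\<^sub>R u"
    by (simp add: scaleR_proj_tensor_def sc)
  show "1 *\<^sub>R u = u"
    by (simp add: scaleR_proj_tensor_def one)
qed

end

instantiation proj_tensor :: (complex_banach, complex_banach) real_normed_vector
begin

lift_definition norm_proj_tensor :: "('a, 'b) proj_tensor \<Rightarrow> real"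
  is "\<lambda>X. lim (\<lambda>n. proj_norm (X n))"
proof -
  fix X Y :: "nat \<Rightarrow> ('a, 'b) alg_tensor"
  assume XY: "ptensor_eq X Y"
  have "(\<lambda>n. proj_norm (X n) - proj_norm (Y n)) \<longlonglongrightarrow> 0"
  proof (rule Lim_null_comparison)
    show "\<forall>\<^sub>F n in sequentially. norm (proj_norm (X n) - proj_norm (Y n)) \<le> proj_norm (X n - Y n)"
      by (simp add: proj_norm_diff_le)
    show "(\<lambda>n. proj_norm (X n - Y n)) \<longlonglongrightarrow> 0" using XY by (simp add: ptensor_eq_def)
  qed
  moreover have "(\<lambda>n. proj_norm (Y n)) \<longlonglongrightarrow> lim (\<lambda>n. proj_norm (Y n))"
    using XY pcauchy_proj_norm_convergent[of Y] by (simp add: ptensor_eq_def convergent_LIMSEQ_iff)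
  ultimately have "(\<lambda>n. (proj_norm (X n) - proj_norm (Y n)) + proj_norm (Y n))
      \<longlonglongrightarrow> 0 + lim (\<lambda>n. proj_norm (Y n))"
    by (intro tendsto_add)
  then show "lim (\<lambda>n. proj_norm (X n)) = lim (\<lambda>n. proj_norm (Y n))"
    by (simp add: limI)
qed

definition dist_proj_tensor :: "('a, 'b) proj_tensor \<Rightarrow> ('a, 'b) proj_tensor \<Rightarrow> real"
  where "dist_proj_tensor u v = norm (u - v)"

definition sgn_proj_tensor :: "('a, 'b) proj_tensor \<Rightarrow> ('a, 'b) proj_tensor"
  where "sgn_proj_tensor u = inverse (norm u) *\<^sub>R u"

definition uniformity_proj_tensor :: "(('a, 'b) proj_tensor \<times> ('a, 'b) proj_tensor) filter"
  where "uniformity_proj_tensor = (INF e\<in>{0<..}. principal {(x, y). dist x y < e})"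

definition open_proj_tensor :: "('a, 'b) proj_tensor set \<Rightarrow> bool"
  where "open_proj_tensor U \<longleftrightarrow> (\<forall>x\<in>U. \<forall>\<^sub>F (x', y) in uniformity. x' = x \<longrightarrow> y \<in> U)"

lemma norm_proj_tensor_tendsto:
  fixes X :: "nat \<Rightarrow> ('a, 'b) alg_tensor"
  assumes "pcauchy X"
  shows "(\<lambda>n. proj_norm (X n)) \<longlonglongrightarrow> norm (abs_proj_tensor X)"
  using pcauchy_proj_norm_convergent[OF assms] assms
  by (simp add: norm_proj_tensor.abs_eq ptensor_eq_refl convergent_LIMSEQ_iff)

lemma proj_tensor_cases:
  obtains X :: "nat \<Rightarrow> ('a, 'b) alg_tensor" where "u = abs_proj_tensor X" "pcauchy X"
  by (metis Quotient3_abs_rep Quotient3_proj_tensor Quotient3_rep_reflp ptensor_eq_def)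

lemma norm_scaleC_proj_tensor:
  fixes u :: "('a, 'b) proj_tensor"
  shows "norm (c *\<^sub>C u) = cmod c * norm u"
proof -
  obtain X :: "nat \<Rightarrow> ('a, 'b) alg_tensor" where X: "u = abs_proj_tensor X" "pcauchy X"
    by (rule proj_tensor_cases)
  have eq: "c *\<^sub>C u = abs_proj_tensor (\<lambda>n. c *\<^sub>C X n)"
    by (simp add: X scaleC_proj_tensor.abs_eq ptensor_eq_refl)
  have "(\<lambda>n. proj_norm (c *\<^sub>C X n)) \<longlonglongrightarrow> norm (c *\<^sub>C u)"
    unfolding eq by (rule norm_proj_tensor_tendsto) (simp add: X pcauchy_scaleC)
  moreover have "(\<lambda>n. proj_norm (c *\<^sub>C X n)) \<longlonglongrightarrow> cmod c * norm u"
    unfolding proj_norm_scaleC X(1)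
    by (intro tendsto_mult tendsto_const norm_proj_tensor_tendsto X)
  ultimately show ?thesis by (rule LIMSEQ_unique)
qed

instance
proof
  fix u v :: "('a, 'b) proj_tensor" and r :: real and U :: "('a, 'b) proj_tensor set"
  show "dist u v = norm (u - v)" by (rule dist_proj_tensor_def)
  show "sgn u = u /\<^sub>R norm u" by (rule sgn_proj_tensor_def)
  show "uniformity = (INF e\<in>{0<..}. principal {(x, y :: ('a, 'b) proj_tensor). dist x y < e})"
    by (rule uniformity_proj_tensor_def)
  show "open U = (\<forall>x\<in>U. \<forall>\<^sub>F (x', y) in uniformity. x' = x \<longrightarrow> y \<in> U)"
    by (rule open_proj_tensor_def)
  obtain X :: "nat \<Rightarrow> ('a, 'b) alg_tensor" where X: "u = abs_proj_tensor X" "pcauchy X"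
    by (rule proj_tensor_cases)
  obtain Y :: "nat \<Rightarrow> ('a, 'b) alg_tensor" where Y: "v = abs_proj_tensor Y" "pcauchy Y"
    by (rule proj_tensor_cases)
  have lX: "(\<lambda>n. proj_norm (X n)) \<longlonglongrightarrow> norm u"
    unfolding X(1) by (rule norm_proj_tensor_tendsto) (rule X)
  have lY: "(\<lambda>n. proj_norm (Y n)) \<longlonglongrightarrow> norm v"
    unfolding Y(1) by (rule norm_proj_tensor_tendsto) (rule Y)
  show "(norm u = 0) = (u = 0)"
  proof
    assume "norm u = 0"
    then have "ptensor_eq X (\<lambda>_. 0)"
      using lX X by (simp add: ptensor_eq_def pcauchy_const)
    then show "u = 0"
      unfolding X(1) zero_proj_tensor_def by (rule Quotient3_rel_abs[OF Quotient3_proj_tensor])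
  next
    assume "u = 0"
    then have "u = abs_proj_tensor (\<lambda>_. 0)" by (simp add: zero_proj_tensor_def)
    then show "norm u = 0"
      using norm_proj_tensor_tendsto[OF pcauchy_const[of "0::('a, 'b) alg_tensor"]]
      by (simp add: LIMSEQ_const_iff)
  qed
  have "(\<lambda>n. proj_norm (X n + Y n)) \<longlonglongrightarrow> norm (u + v)"
    using norm_proj_tensor_tendsto[OF pcauchy_add[OF X(2) Y(2)]] X Y
    by (simp add: plus_proj_tensor.abs_eq ptensor_eq_refl)
  then show "norm (u + v) \<le> norm u + norm v"
    by (rule LIMSEQ_le[OF _ tendsto_add[OF lX lY]]) (auto simp: proj_norm_add)
  show "norm (r *\<^sub>R u) = \<bar>r\<bar> * norm u"
    by (simp add: scaleR_proj_tensor_def norm_scaleC_proj_tensor)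
qed

end

definition of_alg_tensor ::
    "('a::complex_banach, 'b::complex_banach) alg_tensor \<Rightarrow> ('a, 'b) proj_tensor"
  where "of_alg_tensor u = abs_proj_tensor (\<lambda>_. u)"

lemma norm_of_alg_tensor: "norm (of_alg_tensor u) = proj_norm u"
  using norm_proj_tensor_tendsto[OF pcauchy_const[of u]]
  by (simp add: of_alg_tensor_def LIMSEQ_const_iff)

lemma clinear_of_alg_tensor: "clinear of_alg_tensor"
  unfolding clinear_def
  by (simp add: of_alg_tensor_def plus_proj_tensor.abs_eq scaleC_proj_tensor.abs_eq
      ptensor_eq_refl pcauchy_const)

lemma of_alg_tensor_tendsto:
  assumes X: "pcauchy X"
  shows "(\<lambda>n. of_alg_tensor (X n)) \<longlonglongrightarrow> abs_proj_tensor X"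
proof (rule LIMSEQ_I)
  fix e :: real assume e: "e > 0"
  then obtain N where N: "\<And>m n. m \<ge> N \<Longrightarrow> n \<ge> N \<Longrightarrow> proj_norm (X m - X n) < e / 2"
    using X unfolding pcauchy_def by (meson half_gt_zero)
  show "\<exists>N. \<forall>n\<ge>N. norm (of_alg_tensor (X n) - abs_proj_tensor X) < e"
  proof (intro exI allI impI)
    fix n assume n: "n \<ge> N"
    have c: "pcauchy (\<lambda>m. (-1) *\<^sub>C X n + X m)"
      by (intro pcauchy_add pcauchy_const X)
    have "abs_proj_tensor (\<lambda>m. (-1) *\<^sub>C X n + X m) = (-1) *\<^sub>C of_alg_tensor (X n) + abs_proj_tensor X"
      by (simp add: of_alg_tensor_def plus_proj_tensor.abs_eq scaleC_proj_tensor.abs_eq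
          ptensor_eq_refl pcauchy_const X)
    then have "(\<lambda>m. proj_norm (X m - X n)) \<longlonglongrightarrow> norm (abs_proj_tensor X - of_alg_tensor (X n))"
      using norm_proj_tensor_tendsto[OF c] by (simp add: scaleC_minus_one)
    then have "norm (abs_proj_tensor X - of_alg_tensor (X n)) \<le> e / 2"
    proof (rule LIMSEQ_le_const2)
      show "\<exists>M. \<forall>m\<ge>M. proj_norm (X m - X n) \<le> e / 2"
        using N n by (intro exI[of _ N]) (auto intro: less_imp_le)
    qed
    then show "norm (of_alg_tensor (X n) - abs_proj_tensor X) < e"
      using e by (simp add: norm_minus_commute)
  qed
qed

instance proj_tensor :: (complex_banach, complex_banach) complex_banach
proof
  fix c :: complex and u :: "('a, 'b) proj_tensor"
  show "norm (c *\<^sub>C u) = cmod c * norm u" by (rule norm_scaleC_proj_tensor)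
next
  fix U :: "nat \<Rightarrow> ('a, 'b) proj_tensor"
  assume U: "Cauchy U"
  have "\<exists>x. norm (U n - of_alg_tensor x) < inverse (Suc n)" for n
  proof -
    obtain X :: "nat \<Rightarrow> ('a, 'b) alg_tensor" where X: "U n = abs_proj_tensor X" "pcauchy X"
      by (rule proj_tensor_cases)
    then have "\<exists>N. \<forall>m\<ge>N. norm (of_alg_tensor (X m) - U n) < inverse (Suc n)"
      using LIMSEQ_D[OF of_alg_tensor_tendsto[OF X(2)]]
      by (metis X(1) inverse_positive_iff_positive of_nat_0_less_iff zero_less_Suc)
    then show ?thesis by (metis norm_minus_commute order_refl)
  qed
  then obtain x where x: "\<And>n. norm (U n - of_alg_tensor (x n)) < inverse (Suc n)"
    by metis
  have lim0: "(\<lambda>n. U n - of_alg_tensor (x n)) \<longlonglongrightarrow> 0"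
    by (rule Lim_null_comparison[OF _ LIMSEQ_inverse_real_of_nat])
      (use x in \<open>auto intro!: always_eventually less_imp_le\<close>)
  have "Cauchy (\<lambda>n. of_alg_tensor (x n))"
  proof (rule metric_CauchyI)
    fix e :: real assume e: "e > 0"
    obtain N1 where N1: "\<And>m n. m \<ge> N1 \<Longrightarrow> n \<ge> N1 \<Longrightarrow> dist (U m) (U n) < e / 3"
      using metric_CauchyD[OF U, of "e / 3"] e by auto
    obtain N2 where N2: "\<And>n. n \<ge> N2 \<Longrightarrow> dist (U n) (of_alg_tensor (x n)) < e / 3"
      using LIMSEQ_D[OF lim0, of "e / 3"] e by (auto simp: dist_norm)
    show "\<exists>N. \<forall>m\<ge>N. \<forall>n\<ge>N. dist (of_alg_tensor (x m)) (of_alg_tensor (x n)) < e"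
    proof (intro exI allI impI)
      fix m n assume "m \<ge> max N1 N2" "n \<ge> max N1 N2"
      then have "dist (U m) (U n) < e / 3" "dist (U m) (of_alg_tensor (x m)) < e / 3"
          "dist (U n) (of_alg_tensor (x n)) < e / 3"
        using N1 N2 by auto
      then show "dist (of_alg_tensor (x m)) (of_alg_tensor (x n)) < e"
        using dist_triangle[of "of_alg_tensor (x m)" "of_alg_tensor (x n)" "U m"]
          dist_triangle[of "U m" "of_alg_tensor (x n)" "U n"] by (simp add: dist_commute)
    qed
  qed
  then have "pcauchy x"
    unfolding pcauchy_def Cauchy_iff norm_of_alg_tensor[symmetric]
    by (simp add: clinear_diff[OF clinear_of_alg_tensor])
  then have "(\<lambda>n. of_alg_tensor (x n)) \<longlonglongrightarrow> abs_proj_tensor x"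
    by (rule of_alg_tensor_tendsto)
  then have "(\<lambda>n. (U n - of_alg_tensor (x n)) + of_alg_tensor (x n)) \<longlonglongrightarrow> 0 + abs_proj_tensor x"
    by (intro tendsto_add lim0)
  then show "convergent U" by (auto simp: convergent_def)
qed

definition proj_pure ::
    "'a::complex_banach \<Rightarrow> 'b::complex_banach \<Rightarrow> ('a, 'b) proj_tensor"  (infixl \<open>\<otimes>\<^sub>p\<close> 70)
  where "x \<otimes>\<^sub>p y = of_alg_tensor (alg_pure x y)"

lemma bounded_cbilinear_proj_pure:
  "bounded_cbilinear ((\<otimes>\<^sub>p) :: 'a::complex_banach \<Rightarrow> 'b::complex_banach \<Rightarrow> _)"
  using cbilinear_alg_pure[where 'a = 'a and 'b = 'b]
    clinear_of_alg_tensor[where 'a = 'a and 'b = 'b]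
  unfolding bounded_cbilinear_def cbilinear_def clinear_def proj_pure_def
  by (auto simp: norm_of_alg_tensor intro!: exI[of _ 1] proj_norm_alg_pure_le)

lemma proj_tensor_eqI:
  fixes f g :: "('a::complex_banach, 'b::complex_banach) proj_tensor \<Rightarrow> 'c::complex_banach"
  assumes f: "bounded_clinear f" and g: "bounded_clinear g"
    and eq: "\<And>x y. f (x \<otimes>\<^sub>p y) = g (x \<otimes>\<^sub>p y)"
  shows "f = g"
proof
  fix u :: "('a, 'b) proj_tensor"
  have lin: "clinear f" "clinear g" using f g by (auto simp: bounded_clinear_def)
  have *: "f (of_alg_tensor (abs_alg_tensor M)) = g (of_alg_tensor (abs_alg_tensor M))" for M
  proof (induction M)
    case empty
    then show ?case
      using lin by (simp add: abs_alg_tensor_simps clinear_zero clinear_zero[OF clinear_of_alg_tensor])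
  next
    case (add p M)
    obtain x y where p: "p = (x, y)" by (cases p)
    have "of_alg_tensor (abs_alg_tensor (add_mset p M))
        = x \<otimes>\<^sub>p y + of_alg_tensor (abs_alg_tensor M)"
      using abs_alg_tensor_simps(2)[of "{#(x, y)#}" M]
        clinear_of_alg_tensor[where 'a = 'a and 'b = 'b]
      by (simp add: p abs_alg_tensor_simps clinear_def proj_pure_def)
    then show ?case using add eq lin by (simp add: clinear_def)
  qed
  have alg: "f (of_alg_tensor v) = g (of_alg_tensor v)" for v
    by (cases v rule: alg_tensor_cases) (simp add: *)
  obtain X where X: "u = abs_proj_tensor X" "pcauchy X"
    by (rule proj_tensor_cases)
  have l: "(\<lambda>n. of_alg_tensor (X n)) \<longlonglongrightarrow> u"
    using of_alg_tensor_tendsto X by simp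
  have "(\<lambda>n. f (of_alg_tensor (X n))) \<longlonglongrightarrow> f u"
    by (intro bounded_linear.tendsto[OF bounded_clinear_imp_bounded_linear[OF f]] l)
  moreover have "(\<lambda>n. f (of_alg_tensor (X n))) \<longlonglongrightarrow> g u"
    unfolding alg by (intro bounded_linear.tendsto[OF bounded_clinear_imp_bounded_linear[OF g]] l)
  ultimately show "f u = g u" by (rule LIMSEQ_unique)
qed

text \<open>The bounded linear map on the projective tensor product induced by a bounded bilinear map.\<close>

definition proj_lift ::
    "('a::complex_banach \<Rightarrow> 'b::complex_banach \<Rightarrow> 'c::complex_banach) \<Rightarrow> ('a, 'b) proj_tensor \<Rightarrow> 'c"
  where "proj_lift T = (THE f. bounded_clinear f \<and> (\<forall>x y. f (x \<otimes>\<^sub>p y) = T x y))"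

definition mset_eval :: "('a \<Rightarrow> 'b \<Rightarrow> 'c::complex_vector) \<Rightarrow> ('a \<times> 'b) multiset \<Rightarrow> 'c"
  where "mset_eval T M = (\<Sum>(x, y)\<in>#M. T x y)"

lemma mset_eval_simps [simp]:
  "mset_eval T {#} = 0"
  "mset_eval T (add_mset (x, y) M) = T x y + mset_eval T M"
  "mset_eval T (M + N) = mset_eval T M + mset_eval T N"
  by (simp_all add: mset_eval_def)

lemma tensor_eq_mset_eval:
  assumes T: "cbilinear T"
  shows "tensor_eq M N \<Longrightarrow> mset_eval T M = mset_eval T N"
proof (induction rule: tensor_eq.induct)
  case (zero y)
  then show ?case using T clinear_zero[of "\<lambda>x. T x y"] by (simp add: cbilinear_def)
qed (use T in \<open>auto simp: cbilinear_def clinear_def\<close>)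

lemma proj_lift_exists:
  fixes T :: "'a::complex_banach \<Rightarrow> 'b::complex_banach \<Rightarrow> 'c::complex_banach"
  assumes T: "bounded_cbilinear T"
  shows "\<exists>f. bounded_clinear f \<and> (\<forall>x y. f (x \<otimes>\<^sub>p y) = T x y)"
proof -
  have bil: "cbilinear T" using T by (simp add: bounded_cbilinear_def)
  obtain K0 where K0: "\<And>x y. norm (T x y) \<le> K0 * (norm x * norm y)"
    using T by (auto simp: bounded_cbilinear_def)
  define K where "K = \<bar>K0\<bar> + 1"
  have K: "norm (T x y) \<le> K * (norm x * norm y)" for x y
    using K0[of x y] by (rule order_trans) (auto intro!: mult_right_mono simp: K_def)
  have Kpos: "K > 0" by (simp add: K_def)
  define L where "L u = mset_eval T (rep_alg_tensor u)" for u
  have L: "L (abs_alg_tensor M) = mset_eval T M" for M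
  proof -
    have "tensor_eq (rep_alg_tensor (abs_alg_tensor M)) M"
      by (simp add: Quotient3_alg_tensor rep_abs_rsp_left tensor_eq.refl)
    then show ?thesis unfolding L_def by (rule tensor_eq_mset_eval[OF bil])
  qed
  have Ladd: "L (u + v) = L u + L v" for u v
    by (cases u rule: alg_tensor_cases, cases v rule: alg_tensor_cases)
      (simp add: L abs_alg_tensor_simps(2)[symmetric])
  have ev_scale: "mset_eval T (mset_scale c M) = c *\<^sub>C mset_eval T M" for c M
    by (induction M) (use bil in \<open>auto simp: scaleC_add_right cbilinear_def clinear_def\<close>)
  have Lscale: "L (c *\<^sub>C u) = c *\<^sub>C L u" for c u
    by (cases u rule: alg_tensor_cases) (simp add: L abs_alg_tensor_simps(3)[symmetric] ev_scale)
  have Llin: "clinear L" by (simp add: clinear_def Ladd Lscale)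
  have ev_bound: "norm (mset_eval T M) \<le> K * mset_cost M" for M
  proof (induction M)
    case (add p M)
    obtain x y where p: "p = (x, y)" by (cases p)
    have "norm (T x y + mset_eval T M) \<le> norm (T x y) + norm (mset_eval T M)"
      by (rule norm_triangle_ineq)
    then show ?case using add K[of x y] by (simp add: p distrib_left)
  qed simp
  have Lbound: "norm (L u) \<le> K * proj_norm u" for u
  proof (rule ccontr)
    assume "\<not> norm (L u) \<le> K * proj_norm u"
    then have "proj_norm u < norm (L u) / K"
      using Kpos by (simp add: field_simps)
    then obtain M where "u = abs_alg_tensor M" "mset_cost M < norm (L u) / K"
      by (rule proj_norm_lessE)
    then show False using ev_bound[of M] Kpos by (simp add: L field_simps)
  qed
  have conv: "convergent (\<lambda>n. L (X n))" if "pcauchy X" for X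
    unfolding Cauchy_convergent_iff[symmetric]
  proof (rule CauchyI)
    fix e :: real assume "e > 0"
    then have "e / K > 0" using Kpos by simp
    then obtain N where N: "\<And>m n. m \<ge> N \<Longrightarrow> n \<ge> N \<Longrightarrow> proj_norm (X m - X n) < e / K"
      using \<open>pcauchy X\<close> unfolding pcauchy_def by meson
    show "\<exists>N. \<forall>m\<ge>N. \<forall>n\<ge>N. norm (L (X m) - L (X n)) < e"
    proof (intro exI allI impI)
      fix m n assume "m \<ge> N" "n \<ge> N"
      then have "K * proj_norm (X m - X n) < e"
        using N[of m n] Kpos by (simp add: field_simps)
      then show "norm (L (X m) - L (X n)) < e"
        using Lbound[of "X m - X n"] by (simp add: clinear_diff[OF Llin])
    qed
  qed
  define f where "f u = lim (\<lambda>n. L (rep_proj_tensor u n))" for u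
  have f: "(\<lambda>n. L (X n)) \<longlonglongrightarrow> f (abs_proj_tensor X)" if X: "pcauchy X" for X
  proof -
    define Y where "Y = rep_proj_tensor (abs_proj_tensor X)"
    have YX: "ptensor_eq X Y"
      unfolding Y_def by (rule rep_abs_rsp[OF Quotient3_proj_tensor]) (rule ptensor_eq_refl[OF X])
    then have "pcauchy Y" by (simp add: ptensor_eq_def)
    then have "(\<lambda>n. L (Y n)) \<longlonglongrightarrow> f (abs_proj_tensor X)"
      using conv[of Y] by (simp add: f_def Y_def convergent_LIMSEQ_iff)
    moreover have "(\<lambda>n. L (X n) - L (Y n)) \<longlonglongrightarrow> 0"
    proof (rule Lim_null_comparison)
      show "\<forall>\<^sub>F n in sequentially. norm (L (X n) - L (Y n)) \<le> K * proj_norm (X n - Y n)"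
        using Lbound by (simp add: clinear_diff[OF Llin, symmetric])
      have "(\<lambda>n. K * proj_norm (X n - Y n)) \<longlonglongrightarrow> K * 0"
        using YX by (intro tendsto_mult tendsto_const) (simp add: ptensor_eq_def)
      then show "(\<lambda>n. K * proj_norm (X n - Y n)) \<longlonglongrightarrow> 0" by simp
    qed
    ultimately have "(\<lambda>n. L (X n) - L (Y n) + L (Y n)) \<longlonglongrightarrow> 0 + f (abs_proj_tensor X)"
      by (intro tendsto_add)
    then show ?thesis by simp
  qed
  have fadd: "f (u + v) = f u + f v" for u v
  proof -
    obtain X where X: "u = abs_proj_tensor X" "pcauchy X" by (rule proj_tensor_cases)
    obtain Y where Y: "v = abs_proj_tensor Y" "pcauchy Y" by (rule proj_tensor_cases)
    have "(\<lambda>n. L (X n + Y n)) \<longlonglongrightarrow> f (u + v)"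
      using f[OF pcauchy_add[OF X(2) Y(2)]] X Y by (simp add: plus_proj_tensor.abs_eq ptensor_eq_refl)
    moreover have "(\<lambda>n. L (X n + Y n)) \<longlonglongrightarrow> f u + f v"
      unfolding Ladd X(1) Y(1) by (intro tendsto_add f X Y)
    ultimately show ?thesis by (rule LIMSEQ_unique)
  qed
  have fscale: "f (c *\<^sub>C u) = c *\<^sub>C f u" for c u
  proof -
    obtain X where X: "u = abs_proj_tensor X" "pcauchy X" by (rule proj_tensor_cases)
    have "(\<lambda>n. L (c *\<^sub>C X n)) \<longlonglongrightarrow> f (c *\<^sub>C u)"
      using f[OF pcauchy_scaleC[OF X(2)]] X by (simp add: scaleC_proj_tensor.abs_eq ptensor_eq_refl)
    moreover have "(\<lambda>n. L (c *\<^sub>C X n)) \<longlonglongrightarrow> c *\<^sub>C f u"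
      unfolding Lscale X(1) by (intro bounded_linear.tendsto[OF bounded_linear_scaleC] f X)
    ultimately show ?thesis by (rule LIMSEQ_unique)
  qed
  have fbound: "norm (f u) \<le> K * norm u" for u
  proof -
    obtain X where X: "u = abs_proj_tensor X" "pcauchy X" by (rule proj_tensor_cases)
    have "(\<lambda>n. norm (L (X n))) \<longlonglongrightarrow> norm (f u)"
      unfolding X(1) by (intro tendsto_norm f X)
    moreover have "(\<lambda>n. K * proj_norm (X n)) \<longlonglongrightarrow> K * norm u"
      unfolding X(1) by (intro tendsto_mult tendsto_const norm_proj_tensor_tendsto X)
    ultimately show ?thesis by (rule LIMSEQ_le) (auto simp: Lbound)
  qed
  have "bounded_clinear f"
    unfolding bounded_clinear_def clinear_def using fadd fscale fbound by blast
  moreover have "f (x \<otimes>\<^sub>p y) = T x y" for x y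
    using f[OF pcauchy_const[of "alg_pure x y"]] L[of "{#(x, y)#}"]
    by (simp add: proj_pure_def of_alg_tensor_def LIMSEQ_const_iff abs_alg_tensor_simps)
  ultimately show ?thesis by blast
qed

lemma
  assumes "bounded_cbilinear T"
  shows bounded_clinear_proj_lift: "bounded_clinear (proj_lift T)"
    and proj_lift_pure: "proj_lift T (x \<otimes>\<^sub>p y) = T x y"
proof -
  have "\<exists>!f. bounded_clinear f \<and> (\<forall>x y. f (x \<otimes>\<^sub>p y) = T x y)"
    using proj_lift_exists[OF assms] by (intro ex_ex1I) (auto intro: proj_tensor_eqI)
  from theI'[OF this]
  show "bounded_clinear (proj_lift T)" and "proj_lift T (x \<otimes>\<^sub>p y) = T x y"
    by (simp_all add: proj_lift_def)
qed


section \<open>Pseudo-contractibility\<close>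

text \<open>
  The bimodule structure and the product map on the projective tensor product, as the bounded
  linear maps determined by their values on elementary tensors.
\<close>

definition tensor_lmul ::
    "'b::complex_banach_algebra \<Rightarrow> ('b, 'b) proj_tensor \<Rightarrow> ('b, 'b) proj_tensor"
  where "tensor_lmul a = proj_lift (\<lambda>b c. (a * b) \<otimes>\<^sub>p c)"

definition tensor_rmul ::
    "('b, 'b) proj_tensor \<Rightarrow> 'b::complex_banach_algebra \<Rightarrow> ('b, 'b) proj_tensor"
  where "tensor_rmul m a = proj_lift (\<lambda>b c. b \<otimes>\<^sub>p (c * a)) m"

definition tensor_prod :: "('b::complex_banach_algebra, 'b) proj_tensor \<Rightarrow> 'b"
  where "tensor_prod = proj_lift (*)"

lemma bounded_cbilinear_compose:
  fixes T :: "'a::complex_banach \<Rightarrow> 'b::complex_banach \<Rightarrow> 'c::complex_banach"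
    and f :: "'d::complex_banach \<Rightarrow> 'a" and g :: "'e::complex_banach \<Rightarrow> 'b"
  assumes T: "bounded_cbilinear T" and f: "bounded_clinear f" and g: "bounded_clinear g"
  shows "bounded_cbilinear (\<lambda>x y. T (f x) (g y))"
proof -
  obtain K where K: "\<And>x y. norm (T x y) \<le> K * (norm x * norm y)"
    using T by (auto simp: bounded_cbilinear_def)
  obtain F where F: "\<And>x. norm (f x) \<le> F * norm x"
    using f by (auto simp: bounded_clinear_def)
  obtain G where G: "\<And>x. norm (g x) \<le> G * norm x"
    using g by (auto simp: bounded_clinear_def)
  have "norm (T (f x) (g y)) \<le> (\<bar>K\<bar> * \<bar>F\<bar> * \<bar>G\<bar>) * (norm x * norm y)" for x y
  proof -
    have F': "norm (f x) \<le> \<bar>F\<bar> * norm x"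
      using F[of x] by (rule order_trans) (auto intro!: mult_right_mono)
    have G': "norm (g y) \<le> \<bar>G\<bar> * norm y"
      using G[of y] by (rule order_trans) (auto intro!: mult_right_mono)
    have "norm (T (f x) (g y)) \<le> \<bar>K\<bar> * (norm (f x) * norm (g y))"
      using K[of "f x" "g y"] by (rule order_trans) (auto intro!: mult_right_mono)
    also have "\<dots> \<le> \<bar>K\<bar> * ((\<bar>F\<bar> * norm x) * (\<bar>G\<bar> * norm y))"
      by (intro mult_left_mono mult_mono F' G') auto
    finally show ?thesis by (simp add: ac_simps)
  qed
  moreover have "cbilinear (\<lambda>x y. T (f x) (g y))"
    using T f g
    by (simp add: bounded_cbilinear_def cbilinear_def bounded_clinear_def clinear_def)
  ultimately show ?thesis unfolding bounded_cbilinear_def by blast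
qed

lemma bounded_clinear_id: "bounded_clinear (\<lambda>x. x)"
  by (auto simp: bounded_clinear_def clinear_def intro!: exI[of _ 1])

lemma bounded_clinear_mult_left: "bounded_clinear ((*) (a :: 'a::complex_banach_algebra))"
  by (auto simp: bounded_clinear_def clinear_def distrib_left mult_scaleC_right
      intro!: exI[of _ "norm a"] norm_mult_ineq)

lemma bounded_clinear_mult_right: "bounded_clinear (\<lambda>x. x * (a :: 'a::complex_banach_algebra))"
  by (auto simp: bounded_clinear_def clinear_def distrib_right mult_scaleC_left
      intro!: exI[of _ "norm a"] order_trans[OF norm_mult_ineq])

lemma
  fixes a b c :: "'b::complex_banach_algebra"
  shows bounded_clinear_tensor_lmul: "bounded_clinear (tensor_lmul a)"
    and tensor_lmul_pure: "tensor_lmul a (b \<otimes>\<^sub>p c) = (a * b) \<otimes>\<^sub>p c"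
    and bounded_clinear_tensor_rmul: "bounded_clinear (\<lambda>m. tensor_rmul m a)"
    and tensor_rmul_pure: "tensor_rmul (b \<otimes>\<^sub>p c) a = b \<otimes>\<^sub>p (c * a)"
    and bounded_clinear_tensor_prod: "bounded_clinear (tensor_prod :: _ \<Rightarrow> 'b)"
    and tensor_prod_pure: "tensor_prod (b \<otimes>\<^sub>p c) = b * c"
proof -
  have l: "bounded_cbilinear (\<lambda>b c :: 'b. (a * b) \<otimes>\<^sub>p c)"
    by (rule bounded_cbilinear_compose[OF bounded_cbilinear_proj_pure
          bounded_clinear_mult_left bounded_clinear_id])
  have r: "bounded_cbilinear (\<lambda>b c :: 'b. b \<otimes>\<^sub>p (c * a))"
    by (rule bounded_cbilinear_compose[OF bounded_cbilinear_proj_pure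
          bounded_clinear_id bounded_clinear_mult_right])
  show "bounded_clinear (tensor_lmul a)" "tensor_lmul a (b \<otimes>\<^sub>p c) = (a * b) \<otimes>\<^sub>p c"
    unfolding tensor_lmul_def
    by (rule bounded_clinear_proj_lift[OF l]) (rule proj_lift_pure[OF l])
  show "bounded_clinear (\<lambda>m. tensor_rmul m a)" "tensor_rmul (b \<otimes>\<^sub>p c) a = b \<otimes>\<^sub>p (c * a)"
    unfolding tensor_rmul_def
    by (rule bounded_clinear_proj_lift[OF r]) (rule proj_lift_pure[OF r])
  show "bounded_clinear (tensor_prod :: _ \<Rightarrow> 'b)" "tensor_prod (b \<otimes>\<^sub>p c) = b * c"
    unfolding tensor_prod_def
    by (rule bounded_clinear_proj_lift[OF bounded_cbilinear_mult])
      (rule proj_lift_pure[OF bounded_cbilinear_mult])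
qed

definition directed_set :: "'d set \<Rightarrow> ('d \<Rightarrow> 'd \<Rightarrow> bool) \<Rightarrow> bool"
  where "directed_set D le \<longleftrightarrow>
    D \<noteq> {} \<and> (\<forall>i\<in>D. le i i) \<and>
    (\<forall>i\<in>D. \<forall>j\<in>D. \<forall>k\<in>D. le i j \<longrightarrow> le j k \<longrightarrow> le i k) \<and>
    (\<forall>i\<in>D. \<forall>j\<in>D. \<exists>k\<in>D. le i k \<and> le j k)"

definition net_tendsto ::
    "'d set \<Rightarrow> ('d \<Rightarrow> 'd \<Rightarrow> bool) \<Rightarrow> ('d \<Rightarrow> 'x::metric_space) \<Rightarrow> 'x \<Rightarrow> bool"
  where "net_tendsto D le x l \<longleftrightarrow> (\<forall>e>0. \<exists>i0\<in>D. \<forall>i\<in>D. le i0 i \<longrightarrow> dist (x i) l < e)"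

definition pseudo_contractible_net ::
    "'d set \<Rightarrow> ('d \<Rightarrow> 'd \<Rightarrow> bool) \<Rightarrow> ('d \<Rightarrow> ('b::complex_banach_algebra, 'b) proj_tensor) \<Rightarrow> bool"
  where "pseudo_contractible_net D le m \<longleftrightarrow>
    directed_set D le \<and>
    (\<forall>i\<in>D. \<forall>a. tensor_lmul a (m i) = tensor_rmul (m i) a) \<and>
    (\<forall>a. net_tendsto D le (\<lambda>i. tensor_prod (m i) * a) a)"

text \<open>
  HOL cannot quantify existentially over the type of the index set of a net, so the definition
  fixes one that is large enough; the lemma \<open>pseudo_contractibleI\<close> shows that a net
  with an arbitrary index type suffices.
\<close>

definition pseudo_contractible :: "'b::complex_banach_algebra itself \<Rightarrow> bool"
  where "pseudo_contractible _ \<longleftrightarrow>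
    (\<exists>(D :: ('b set \<times> nat) set) le (m :: 'b set \<times> nat \<Rightarrow> ('b, 'b) proj_tensor).
      pseudo_contractible_net D le m)"

lemma pseudo_contractibleI:
  fixes D :: "'d set" and m :: "'d \<Rightarrow> ('b::complex_banach_algebra, 'b) proj_tensor"
  assumes net: "pseudo_contractible_net D le m"
  shows "pseudo_contractible TYPE('b)"
proof -
  have dir: "directed_set D le"
    and comm: "\<And>i a. i \<in> D \<Longrightarrow> tensor_lmul a (m i) = tensor_rmul (m i) a"
    and lim: "\<And>a. net_tendsto D le (\<lambda>i. tensor_prod (m i) * a) a"
    using net by (auto simp: pseudo_contractible_net_def)
  have trans: "\<And>i j k. i \<in> D \<Longrightarrow> j \<in> D \<Longrightarrow> k \<in> D \<Longrightarrow> le i j \<Longrightarrow> le j k \<Longrightarrow> le i k"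
    and upper: "\<And>i j. i \<in> D \<Longrightarrow> j \<in> D \<Longrightarrow> \<exists>k\<in>D. le i k \<and> le j k"
    and refl: "\<And>i. i \<in> D \<Longrightarrow> le i i" and ne: "D \<noteq> {}"
    using dir unfolding directed_set_def by blast+
  have ev: "\<exists>i0\<in>D. \<forall>i\<in>D. le i0 i \<longrightarrow> (\<forall>a\<in>S. dist (tensor_prod (m i) * a) a < e)"
    if "finite S" "e > 0" for S :: "'b set" and e :: real
    using \<open>finite S\<close>
  proof induction
    case empty
    then show ?case using ne by auto
  next
    case (insert a S)
    obtain i0 where i0: "i0 \<in> D" "\<And>i. i \<in> D \<Longrightarrow> le i0 i \<Longrightarrow> \<forall>a\<in>S. dist (tensor_prod (m i) * a) a < e"
      using insert.IH by blast
    obtain j0 where j0: "j0 \<in> D" "\<And>i. i \<in> D \<Longrightarrow> le j0 i \<Longrightarrow> dist (tensor_prod (m i) * a) a < e"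
      using lim[of a] \<open>e > 0\<close> unfolding net_tendsto_def by meson
    obtain k where k: "k \<in> D" "le i0 k" "le j0 k"
      using upper[OF i0(1) j0(1)] by blast
    show ?case
    proof (intro bexI[of _ k] ballI impI)
      fix i b assume "i \<in> D" "le k i" "b \<in> insert a S"
      then show "dist (tensor_prod (m i) * b) b < e"
        using i0(2)[of i] j0(2)[of i] trans[of i0 k i] trans[of j0 k i] k i0(1) j0(1) by auto
    qed (rule k)
  qed
  have ex: "\<exists>i\<in>D. finite S \<longrightarrow> (\<forall>a\<in>S. dist (tensor_prod (m i) * a) a < inverse (Suc n))"
    for S :: "'b set" and n :: nat
  proof (cases "finite S")
    case True
    then obtain i0 where "i0 \<in> D"
        "\<And>i. i \<in> D \<Longrightarrow> le i0 i \<Longrightarrow> \<forall>a\<in>S. dist (tensor_prod (m i) * a) a < inverse (Suc n)"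
      using ev[of S "inverse (Suc n)"] by force
    then show ?thesis using refl by blast
  qed (use ne in auto)
  define c where "c p = (SOME i. i \<in> D \<and> (finite (fst p) \<longrightarrow>
      (\<forall>a\<in>fst p. dist (tensor_prod (m i) * a) a < inverse (Suc (snd p)))))" for p :: "'b set \<times> nat"
  have c: "c p \<in> D \<and> (finite (fst p) \<longrightarrow>
      (\<forall>a\<in>fst p. dist (tensor_prod (m (c p)) * a) a < inverse (Suc (snd p))))" for p
    unfolding c_def by (rule someI_ex) (use ex[of "fst p" "snd p"] in blast)
  define D' :: "('b set \<times> nat) set" where "D' = {p. finite (fst p)}"
  define le' :: "'b set \<times> nat \<Rightarrow> 'b set \<times> nat \<Rightarrow> bool"
    where "le' p q \<longleftrightarrow> fst p \<subseteq> fst q \<and> snd p \<le> snd q" for p q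
  have "directed_set D' le'"
    unfolding directed_set_def
  proof (intro conjI ballI impI)
    show "D' \<noteq> {}" by (auto simp: D'_def intro!: exI[of _ "{}"])
    fix p q assume "p \<in> D'" "q \<in> D'"
    then show "\<exists>r\<in>D'. le' p r \<and> le' q r"
      by (intro bexI[of _ "(fst p \<union> fst q, max (snd p) (snd q))"]) (auto simp: D'_def le'_def)
  qed (auto simp: le'_def)
  moreover have "net_tendsto D' le' (\<lambda>p. tensor_prod (m (c p)) * a) a" for a
    unfolding net_tendsto_def
  proof (intro allI impI)
    fix e :: real assume "e > 0"
    then obtain n where n: "inverse (Suc n) < e" using reals_Archimedean by blast
    show "\<exists>p0\<in>D'. \<forall>p\<in>D'. le' p0 p \<longrightarrow> dist (tensor_prod (m (c p)) * a) a < e"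
    proof (intro bexI[of _ "({a}, n)"] ballI impI)
      fix p assume p: "p \<in> D'" "le' ({a}, n) p"
      then have "dist (tensor_prod (m (c p)) * a) a < inverse (Suc (snd p))"
        using c[of p] by (auto simp: D'_def le'_def)
      also have "\<dots> \<le> inverse (Suc n)"
        using p by (auto simp: le'_def)
      finally show "dist (tensor_prod (m (c p)) * a) a < e" using n by simp
    qed (simp add: D'_def)
  qed
  ultimately have "pseudo_contractible_net D' le' (\<lambda>p. m (c p))"
    using comm c unfolding pseudo_contractible_net_def by blast
  then show ?thesis unfolding pseudo_contractible_def by blast
qed


section \<open>The character space\<close>

text \<open>Characters are automatically continuous, so continuity is not demanded.\<close>

definition character_space :: "('a::complex_banach_algebra \<Rightarrow> complex) set"
  where "character_space =
    {\<phi>. clinear \<phi> \<and> (\<forall>x y. \<phi> (x * y) = \<phi> x * \<phi> y) \<and> \<phi> \<noteq> (\<lambda>_. 0)}"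


section \<open>The algebra of upper triangular matrices\<close>

text \<open>
  The totally ordered index set is the universe of \<open>'i\<close>, which like every type is non-empty.
\<close>

typedef (overloaded) ('i::linorder, 'a::complex_banach_algebra) UP =
  "{f :: 'i \<Rightarrow> 'i \<Rightarrow> 'a. (\<forall>i j. \<not> i \<le> j \<longrightarrow> f i j = 0) \<and>
      (\<lambda>(i, j). norm (f i j)) summable_on UNIV}"
  morphisms entry UP_of
  by (rule exI[of _ "\<lambda>_ _. 0"]) (auto simp: case_prod_unfold)

setup_lifting type_definition_UP

lemma entry_eq_0: "\<not> i \<le> j \<Longrightarrow> entry A i j = 0"
  using entry[of A] by blast

lemma entry_summable: "(\<lambda>(i, j). norm (entry A i j)) summable_on UNIV"
  using entry[of A] by blast

lemma UP_eqI: "(\<And>i j. entry A i j = entry B i j) \<Longrightarrow> A = B"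
  by (simp add: entry_inject[symmetric] fun_eq_iff)

lemma summable_on_norm_le:
  fixes f :: "'x \<Rightarrow> 'a::real_normed_vector" and g :: "'x \<Rightarrow> real"
  assumes "g summable_on A" "\<And>x. x \<in> A \<Longrightarrow> norm (f x) \<le> g x"
  shows "(\<lambda>x. norm (f x)) summable_on A"
  by (rule summable_on_comparison_test[OF assms(1)]) (use assms(2) in auto)

lemma summable_on_inj:
  fixes f :: "'x \<Rightarrow> real"
  assumes "f summable_on UNIV" "inj h"
  shows "(\<lambda>y. f (h y)) summable_on UNIV"
proof -
  have "f summable_on range h"
    by (rule summable_on_subset_banach[OF assms(1)]) simp
  then show ?thesis using summable_on_reindex[OF assms(2), of f] by (simp add: o_def)
qed

lemma infsum_inj_le:
  fixes f :: "'x \<Rightarrow> real"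
  assumes "f summable_on UNIV" "inj h" "\<And>x. 0 \<le> f x"
  shows "(\<Sum>\<^sub>\<infinity>y. f (h y)) \<le> (\<Sum>\<^sub>\<infinity>x. f x)"
proof -
  have s: "f summable_on range h"
    by (rule summable_on_subset_banach[OF assms(1)]) simp
  have "(\<Sum>\<^sub>\<infinity>y. f (h y)) = infsum f (range h)"
    using infsum_reindex[OF assms(2), of f] by (simp add: o_def)
  also have "\<dots> \<le> infsum f UNIV"
    by (rule infsum_mono2[OF s assms(1)]) (auto simp: assms(3))
  finally show ?thesis .
qed

instantiation UP :: (linorder, complex_banach_algebra) complex_vector
begin

lift_definition zero_UP :: "('a, 'b) UP" is "\<lambda>_ _. 0"
  by (auto simp: case_prod_unfold)

lift_definition plus_UP :: "('a, 'b) UP \<Rightarrow> ('a, 'b) UP \<Rightarrow> ('a, 'b) UP"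
  is "\<lambda>f g i j. f i j + g i j"
proof (intro CollectI conjI allI impI)
  fix f g :: "'a \<Rightarrow> 'a \<Rightarrow> 'b"
  assume f: "(\<forall>i j. \<not> i \<le> j \<longrightarrow> f i j = 0) \<and> (\<lambda>(i, j). norm (f i j)) summable_on UNIV"
    and g: "(\<forall>i j. \<not> i \<le> j \<longrightarrow> g i j = 0) \<and> (\<lambda>(i, j). norm (g i j)) summable_on UNIV"
  show "f i j + g i j = 0" if "\<not> i \<le> j" for i j using f g that by simp
  have "(\<lambda>p. norm (f (fst p) (snd p)) + norm (g (fst p) (snd p))) summable_on UNIV"
    using f g by (intro summable_on_add) (auto simp: case_prod_unfold)
  then show "(\<lambda>(i, j). norm (f i j + g i j)) summable_on UNIV"
    unfolding case_prod_unfold by (rule summable_on_norm_le) (rule norm_triangle_ineq)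
qed

lift_definition scaleC_UP :: "complex \<Rightarrow> ('a, 'b) UP \<Rightarrow> ('a, 'b) UP"
  is "\<lambda>c f i j. c *\<^sub>C f i j"
  by (auto simp: case_prod_unfold norm_scaleC intro: summable_on_cmult_right)

definition scaleR_UP :: "real \<Rightarrow> ('a, 'b) UP \<Rightarrow> ('a, 'b) UP"
  where "scaleR_UP r A = complex_of_real r *\<^sub>C A"

definition uminus_UP :: "('a, 'b) UP \<Rightarrow> ('a, 'b) UP"
  where "uminus_UP A = (-1) *\<^sub>C A"

definition minus_UP :: "('a, 'b) UP \<Rightarrow> ('a, 'b) UP \<Rightarrow> ('a, 'b) UP"
  where "minus_UP A B = A + (- B)"

lemma entry_simps [simp]:
  fixes A B :: "('a, 'b) UP"
  shows "entry (0 :: ('a, 'b) UP) i j = 0"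
    and "entry (A + B) i j = entry A i j + entry B i j"
    and "entry (c *\<^sub>C A) i j = c *\<^sub>C entry A i j"
    and "entry (r *\<^sub>R A) i j = r *\<^sub>R entry A i j"
    and "entry (- A) i j = - entry A i j"
    and "entry (A - B) i j = entry A i j - entry B i j"
  by (simp_all add: zero_UP.rep_eq plus_UP.rep_eq scaleC_UP.rep_eq scaleR_UP_def uminus_UP_def
      minus_UP_def scaleR_scaleC scaleC_minus_one)

instance
  by intro_classes
    (auto intro!: UP_eqI simp: add.assoc add.commute scaleC_add_left scaleC_add_right
      scaleC_scaleC scaleR_add_left scaleR_add_right scaleR_scaleC)

end

instantiation UP :: (linorder, complex_banach_algebra) real_normed_vector
begin

definition norm_UP :: "('a, 'b) UP \<Rightarrow> real"
  where "norm_UP A = (\<Sum>\<^sub>\<infinity>(i, j). norm (entry A i j))"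

definition dist_UP :: "('a, 'b) UP \<Rightarrow> ('a, 'b) UP \<Rightarrow> real"
  where "dist_UP A B = norm (A - B)"

definition sgn_UP :: "('a, 'b) UP \<Rightarrow> ('a, 'b) UP"
  where "sgn_UP A = inverse (norm A) *\<^sub>R A"

definition uniformity_UP :: "(('a, 'b) UP \<times> ('a, 'b) UP) filter"
  where "uniformity_UP = (INF e\<in>{0<..}. principal {(x, y). dist x y < e})"

definition open_UP :: "('a, 'b) UP set \<Rightarrow> bool"
  where "open_UP U \<longleftrightarrow> (\<forall>x\<in>U. \<forall>\<^sub>F (x', y) in uniformity. x' = x \<longrightarrow> y \<in> U)"

lemma entry_summable': "(\<lambda>p. norm (entry A (fst p) (snd p))) summable_on UNIV"
  using entry_summable[of A] by (simp add: case_prod_unfold)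

lemma norm_UP_eq: "norm A = (\<Sum>\<^sub>\<infinity>p. norm (entry A (fst p) (snd p)))"
  by (simp add: norm_UP_def case_prod_unfold)

lemma norm_entry_le: "norm (entry A i j) \<le> norm (A :: ('a, 'b) UP)"
  using finite_sum_le_infsum[OF entry_summable'[of A], of "{(i, j)}"] by (simp add: norm_UP_eq)

instance
proof
  fix A B :: "('a, 'b) UP" and r :: real and U :: "('a, 'b) UP set"
  show "dist A B = norm (A - B)" by (rule dist_UP_def)
  show "sgn A = A /\<^sub>R norm A" by (rule sgn_UP_def)
  show "uniformity = (INF e\<in>{0<..}. principal {(x, y :: ('a, 'b) UP). dist x y < e})"
    by (rule uniformity_UP_def)
  show "open U = (\<forall>x\<in>U. \<forall>\<^sub>F (x', y) in uniformity. x' = x \<longrightarrow> y \<in> U)"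
    by (rule open_UP_def)
  show "(norm A = 0) = (A = 0)"
  proof
    assume "norm A = 0"
    then have "entry A i j = 0" for i j
      using norm_entry_le[of A i j] by simp
    then show "A = 0" by (intro UP_eqI) simp
  qed (simp add: norm_UP_eq)
  have "norm (A + B) \<le> (\<Sum>\<^sub>\<infinity>p. norm (entry A (fst p) (snd p)) + norm (entry B (fst p) (snd p)))"
    unfolding norm_UP_eq
    by (intro infsum_mono entry_summable' summable_on_add) (simp add: norm_triangle_ineq)
  also have "\<dots> = norm A + norm B"
    unfolding norm_UP_eq by (intro infsum_add entry_summable')
  finally show "norm (A + B) \<le> norm A + norm B" .
  show "norm (r *\<^sub>R A) = \<bar>r\<bar> * norm A"
    unfolding norm_UP_eq by (simp add: infsum_cmult_right')
qed

end

instance UP :: (linorder, complex_banach_algebra) complex_banach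
proof
  fix c :: complex and A :: "('a, 'b) UP"
  show "norm (c *\<^sub>C A) = cmod c * norm A"
    unfolding norm_UP_eq by (simp add: norm_scaleC infsum_cmult_right')
next
  fix X :: "nat \<Rightarrow> ('a, 'b) UP"
  assume X: "Cauchy X"
  have "convergent (\<lambda>n. entry (X n) i j)" for i j
    unfolding Cauchy_convergent_iff[symmetric]
  proof (rule CauchyI)
    fix e :: real assume "e > 0"
    then obtain N where N: "\<And>m n. m \<ge> N \<Longrightarrow> n \<ge> N \<Longrightarrow> norm (X m - X n) < e"
      using CauchyD[OF X] by meson
    show "\<exists>N. \<forall>m\<ge>N. \<forall>n\<ge>N. norm (entry (X m) i j - entry (X n) i j) < e"
      using N norm_entry_le[of "X _ - X _" i j] by (metis entry_simps(6) le_less_trans)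
  qed
  then obtain L where L: "\<And>i j. (\<lambda>n. entry (X n) i j) \<longlonglongrightarrow> L i j"
    unfolding convergent_def by metis
  have close: "(\<lambda>p. norm (entry (X n) (fst p) (snd p) - L (fst p) (snd p))) summable_on UNIV \<and>
      (\<Sum>\<^sub>\<infinity>p. norm (entry (X n) (fst p) (snd p) - L (fst p) (snd p))) \<le> e"
    if N: "\<And>m n. m \<ge> N \<Longrightarrow> n \<ge> N \<Longrightarrow> norm (X m - X n) < e" and n: "n \<ge> N" for N n e
  proof -
    have fin: "(\<Sum>p\<in>F. norm (entry (X n) (fst p) (snd p) - L (fst p) (snd p))) \<le> e"
      if F: "finite F" for F
    proof (rule LIMSEQ_le_const2)
      show "(\<lambda>m. \<Sum>p\<in>F. norm (entry (X n) (fst p) (snd p) - entry (X m) (fst p) (snd p)))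
          \<longlonglongrightarrow> (\<Sum>p\<in>F. norm (entry (X n) (fst p) (snd p) - L (fst p) (snd p)))"
        by (intro tendsto_sum tendsto_norm tendsto_diff tendsto_const L)
      show "\<exists>M. \<forall>m\<ge>M. (\<Sum>p\<in>F. norm (entry (X n) (fst p) (snd p) - entry (X m) (fst p) (snd p))) \<le> e"
      proof (intro exI allI impI)
        fix m assume m: "m \<ge> N"
        have "(\<Sum>p\<in>F. norm (entry (X n - X m) (fst p) (snd p))) \<le> norm (X n - X m)"
          unfolding norm_UP_eq by (rule finite_sum_le_infsum[OF entry_summable' F]) auto
        then show "(\<Sum>p\<in>F. norm (entry (X n) (fst p) (snd p) - entry (X m) (fst p) (snd p))) \<le> e"
          using N[OF n m] by simp
      qed
    qed
    have s: "(\<lambda>p. norm (entry (X n) (fst p) (snd p) - L (fst p) (snd p))) summable_on UNIV"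
      by (rule nonneg_bdd_above_summable_on) (use fin in \<open>auto intro!: bdd_aboveI2\<close>)
    then show ?thesis using infsum_le_finite_sums[OF s fin] by simp
  qed
  obtain N where N: "\<And>m n. m \<ge> N \<Longrightarrow> n \<ge> N \<Longrightarrow> norm (X m - X n) < 1"
    using CauchyD[OF X, of 1] by auto
  have "(\<lambda>p. norm (entry (X N) (fst p) (snd p) - L (fst p) (snd p)) +
      norm (entry (X N) (fst p) (snd p))) summable_on UNIV"
    using close[OF N, of N] by (intro summable_on_add entry_summable') auto
  then have "(\<lambda>p. norm (L (fst p) (snd p))) summable_on UNIV"
    by (rule summable_on_norm_le)
      (metis add.commute norm_minus_commute norm_triangle_sub)
  moreover have "L i j = 0" if "\<not> i \<le> j" for i j
    using L[of i j] that by (simp add: entry_eq_0 LIMSEQ_const_iff)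
  ultimately have "L \<in> {f. (\<forall>i j. \<not> i \<le> j \<longrightarrow> f i j = 0) \<and> (\<lambda>(i, j). norm (f i j)) summable_on UNIV}"
    by (simp add: case_prod_unfold)
  then have eL: "entry (UP_of L) = L" by (rule UP_of_inverse)
  have "X \<longlonglongrightarrow> UP_of L"
  proof (rule LIMSEQ_I)
    fix e :: real assume e: "e > 0"
    then obtain N where N: "\<And>m n. m \<ge> N \<Longrightarrow> n \<ge> N \<Longrightarrow> norm (X m - X n) < e / 2"
      using CauchyD[OF X, of "e / 2"] by auto
    have "norm (X n - UP_of L) < e" if "n \<ge> N" for n
      using close[OF N that] e by (simp add: norm_UP_eq eL)
    then show "\<exists>N. \<forall>n\<ge>N. norm (X n - UP_of L) < e" by blast
  qed
  then show "convergent X" by (auto simp: convergent_def)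
qed

lemma UP_mult_triple:
  fixes A B :: "('i::linorder, 'a::complex_banach_algebra) UP"
  shows "(\<lambda>((i, j), k). norm (entry A i k) * norm (entry B k j)) summable_on UNIV"
    and "(\<Sum>\<^sub>\<infinity>((i, j), k). norm (entry A i k) * norm (entry B k j)) \<le> norm A * norm B"
proof -
  define a where "a = (\<lambda>p. norm (entry A (fst p) (snd p)))"
  define b where "b = (\<lambda>p. norm (entry B (fst p) (snd p)))"
  have a: "a summable_on UNIV" "infsum a UNIV = norm A" "\<And>p. 0 \<le> a p"
    using entry_summable'[of A] by (simp_all add: a_def norm_UP_eq)
  have b: "b summable_on UNIV" "infsum b UNIV = norm B" "\<And>p. 0 \<le> b p"
    using entry_summable'[of B] by (simp_all add: b_def norm_UP_eq)
  define P where "P = (\<lambda>(p, q). a p * b q)"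
  have "(\<lambda>p. norm (P p)) summable_on UNIV \<times> UNIV"
  proof (rule iffD2[OF Infinite_Sum.abs_summable_on_Sigma_iff], intro conjI ballI)
    fix p
    show "(\<lambda>q. norm (P (p, q))) summable_on UNIV"
      using summable_on_cmult_right[OF b(1), of "a p"] a b by (simp add: P_def abs_mult)
  next
    have "(\<lambda>p. a p * norm B) summable_on UNIV"
      by (rule summable_on_cmult_left[OF a(1)])
    then show "(\<lambda>p. norm (\<Sum>\<^sub>\<infinity>q. norm (P (p, q)))) summable_on UNIV"
      using a b by (simp add: P_def abs_mult infsum_cmult_right')
  qed
  then have P: "P summable_on UNIV \<times> UNIV"
    by (rule abs_summable_summable)
  have "infsum P (UNIV \<times> UNIV) = (\<Sum>\<^sub>\<infinity>p. \<Sum>\<^sub>\<infinity>q. a p * b q)"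
    using infsum_Sigma_banach[OF P] by (simp add: P_def)
  also have "\<dots> = norm A * norm B"
    using a b by (simp add: infsum_cmult_right' infsum_cmult_left')
  finally have PAB: "infsum P UNIV = norm A * norm B" by simp
  define h :: "('i \<times> 'i) \<times> 'i \<Rightarrow> ('i \<times> 'i) \<times> ('i \<times> 'i)"
    where "h = (\<lambda>((i, j), k). ((i, k), (k, j)))"
  have h: "inj h" by (auto simp: h_def inj_on_def)
  have eq: "(\<lambda>((i, j), k). norm (entry A i k) * norm (entry B k j)) = (\<lambda>y. P (h y))"
    by (auto simp: P_def h_def a_def b_def fun_eq_iff)
  show "(\<lambda>((i, j), k). norm (entry A i k) * norm (entry B k j)) summable_on UNIV"
    unfolding eq by (rule summable_on_inj[OF _ h]) (use P in simp)
  show "(\<Sum>\<^sub>\<infinity>((i, j), k). norm (entry A i k) * norm (entry B k j)) \<le> norm A * norm B"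
    unfolding eq PAB[symmetric]
    by (rule infsum_inj_le[OF _ h]) (use P a b in \<open>auto simp: P_def\<close>)
qed

lemma UP_mult_abs_summable:
  fixes A B :: "('i::linorder, 'a::complex_banach_algebra) UP"
  shows "(\<lambda>k. norm (entry A i k) * norm (entry B k j)) summable_on UNIV"
  using summable_on_inj[OF UP_mult_triple(1)[of A B], of "\<lambda>k. ((i, j), k)"]
  by (auto simp: inj_on_def)

lemma UP_mult_summable:
  fixes A B :: "('i::linorder, 'a::complex_banach_algebra) UP"
  shows "(\<lambda>k. entry A i k * entry B k j) summable_on UNIV"
  by (rule abs_summable_summable, rule summable_on_norm_le[OF UP_mult_abs_summable[of A i B j]])
    (rule norm_mult_ineq)

lemma UP_mult_norm_entry:
  fixes A B :: "('i::linorder, 'a::complex_banach_algebra) UP"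
  shows "norm (\<Sum>\<^sub>\<infinity>k. entry A i k * entry B k j)
    \<le> (\<Sum>\<^sub>\<infinity>k. norm (entry A i k) * norm (entry B k j))"
proof -
  have s: "(\<lambda>k. norm (entry A i k * entry B k j)) summable_on UNIV"
    by (rule summable_on_norm_le[OF UP_mult_abs_summable[of A i B j]]) (rule norm_mult_ineq)
  have "norm (\<Sum>\<^sub>\<infinity>k. entry A i k * entry B k j) \<le> (\<Sum>\<^sub>\<infinity>k. norm (entry A i k * entry B k j))"
    by (rule norm_infsum_bound[OF s])
  also have "\<dots> \<le> (\<Sum>\<^sub>\<infinity>k. norm (entry A i k) * norm (entry B k j))"
    by (rule infsum_mono[OF s UP_mult_abs_summable]) (rule norm_mult_ineq)
  finally show ?thesis .
qed

lemma UP_mult_double: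
  fixes A B :: "('i::linorder, 'a::complex_banach_algebra) UP"
  shows "(\<lambda>p. \<Sum>\<^sub>\<infinity>k. norm (entry A (fst p) k) * norm (entry B k (snd p))) summable_on UNIV"
    and "(\<Sum>\<^sub>\<infinity>p. \<Sum>\<^sub>\<infinity>k. norm (entry A (fst p) k) * norm (entry B k (snd p))) \<le> norm A * norm B"
proof -
  have eq: "(\<lambda>((i, j), k). norm (entry A i k) * norm (entry B k j)) =
      (\<lambda>(p, k). norm (entry A (fst p) k) * norm (entry B k (snd p)))"
    by auto
  have s: "(\<lambda>(p, k). norm (entry A (fst p) k) * norm (entry B k (snd p))) summable_on UNIV \<times> UNIV"
    using UP_mult_triple(1)[of A B] unfolding eq by simp
  show "(\<lambda>p. \<Sum>\<^sub>\<infinity>k. norm (entry A (fst p) k) * norm (entry B k (snd p))) summable_on UNIV"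
    by (rule summable_on_Sigma_banach[OF s])
  show "(\<Sum>\<^sub>\<infinity>p. \<Sum>\<^sub>\<infinity>k. norm (entry A (fst p) k) * norm (entry B k (snd p))) \<le> norm A * norm B"
    using UP_mult_triple(2)[of A B] unfolding eq infsum_Sigma'_banach[OF s] by simp
qed

instantiation UP :: (linorder, complex_banach_algebra) complex_banach_algebra
begin

lift_definition times_UP :: "('a, 'b) UP \<Rightarrow> ('a, 'b) UP \<Rightarrow> ('a, 'b) UP"
  is "\<lambda>f g i j. \<Sum>\<^sub>\<infinity>k. f i k * g k j"
proof (intro CollectI conjI allI impI)
  fix f g :: "'a \<Rightarrow> 'a \<Rightarrow> 'b"
  assume f: "(\<forall>i j. \<not> i \<le> j \<longrightarrow> f i j = 0) \<and> (\<lambda>(i, j). norm (f i j)) summable_on UNIV"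
    and g: "(\<forall>i j. \<not> i \<le> j \<longrightarrow> g i j = 0) \<and> (\<lambda>(i, j). norm (g i j)) summable_on UNIV"
  show "(\<Sum>\<^sub>\<infinity>k. f i k * g k j) = 0" if ij: "\<not> i \<le> j" for i j
  proof (rule infsum_0)
    fix k
    show "f i k * g k j = 0"
    proof (cases "i \<le> k")
      case True
      then have "\<not> k \<le> j" using ij by auto
      then show ?thesis using g by simp
    qed (use f in simp)
  qed
  have fg: "entry (UP_of f) = f" "entry (UP_of g) = g"
    using f g by (simp_all add: UP_of_inverse)
  have "(\<lambda>p. norm (\<Sum>\<^sub>\<infinity>k. entry (UP_of f) (fst p) k * entry (UP_of g) k (snd p))) summable_on UNIV"
    by (rule summable_on_norm_le[OF UP_mult_double(1)]) (rule UP_mult_norm_entry)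
  from this[unfolded fg] show "(\<lambda>(i, j). norm (\<Sum>\<^sub>\<infinity>k. f i k * g k j)) summable_on UNIV"
    by (simp add: case_prod_unfold)
qed

lemma entry_times: "entry (A * B) i j = (\<Sum>\<^sub>\<infinity>k. entry A i k * entry B k j)"
  by (simp add: times_UP.rep_eq)

instance
proof
  fix A B C :: "('a, 'b) UP" and c :: complex and r :: real
  show "A * B * C = A * (B * C)"
  proof (rule UP_eqI)
    fix i j
    have s: "(\<lambda>(l, k). entry A i k * entry B k l * entry C l j) summable_on UNIV \<times> UNIV"
    proof (rule abs_summable_summable)
      have "(\<lambda>((i, l), k). norm (entry A i k) * norm (entry B k l)) summable_on UNIV"
        by (rule UP_mult_triple)
      from summable_on_inj[OF this, of "\<lambda>p. ((i, fst p), snd p)"]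
      have "(\<lambda>p. norm (entry A i (snd p)) * norm (entry B (snd p) (fst p))) summable_on UNIV"
        by (simp add: inj_on_def prod_eq_iff)
      then have "(\<lambda>p. norm (entry A i (snd p)) * norm (entry B (snd p) (fst p)) * norm C) summable_on UNIV"
        by (rule summable_on_cmult_left)
      then show "(\<lambda>p. norm (case p of (l, k) \<Rightarrow> entry A i k * entry B k l * entry C l j))
          summable_on UNIV \<times> UNIV"
        unfolding UNIV_Times_UNIV
      proof (rule summable_on_norm_le)
        fix p :: "'a \<times> 'a"
        obtain l k where p: "p = (l, k)" by (cases p)
        have "norm (entry A i k * entry B k l * entry C l j)
            \<le> norm (entry A i k * entry B k l) * norm (entry C l j)"
          by (rule norm_mult_ineq)
        also have "\<dots> \<le> (norm (entry A i k) * norm (entry B k l)) * norm C"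
          by (intro mult_mono norm_mult_ineq norm_entry_le) auto
        finally show "norm (case p of (l, k) \<Rightarrow> entry A i k * entry B k l * entry C l j)
            \<le> norm (entry A i (snd p)) * norm (entry B (snd p) (fst p)) * norm C"
          by (simp add: p)
      qed
    qed
    have "entry (A * B * C) i j = (\<Sum>\<^sub>\<infinity>l. \<Sum>\<^sub>\<infinity>k. entry A i k * entry B k l * entry C l j)"
      unfolding entry_times
      by (intro infsum_cong infsum_cmult_left[symmetric] UP_mult_summable)
    also have "\<dots> = (\<Sum>\<^sub>\<infinity>k. \<Sum>\<^sub>\<infinity>l. entry A i k * entry B k l * entry C l j)"
      by (rule infsum_swap_banach[OF s])
    also have "\<dots> = (\<Sum>\<^sub>\<infinity>k. \<Sum>\<^sub>\<infinity>l. entry A i k * (entry B k l * entry C l j))"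
      by (simp add: mult.assoc)
    also have "\<dots> = entry (A * (B * C)) i j"
      unfolding entry_times by (intro infsum_cong infsum_cmult_right UP_mult_summable)
    finally show "entry (A * B * C) i j = entry (A * (B * C)) i j" .
  qed
  show "(A + B) * C = A * C + B * C"
    by (rule UP_eqI) (simp add: entry_times distrib_right infsum_add UP_mult_summable)
  show "A * (B + C) = A * B + A * C"
    by (rule UP_eqI) (simp add: entry_times distrib_left infsum_add UP_mult_summable)
  have infsum_scaleC: "(\<Sum>\<^sub>\<infinity>k. c *\<^sub>C (entry A i k * entry B k j))
      = c *\<^sub>C (\<Sum>\<^sub>\<infinity>k. entry A i k * entry B k j)" for c i j
    by (rule infsumI, rule has_sum_bounded_linear[OF bounded_linear_scaleC])
      (simp add: UP_mult_summable)
  show l: "c *\<^sub>C A * B = c *\<^sub>C (A * B)" for c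
    by (rule UP_eqI) (simp add: entry_times mult_scaleC_left infsum_scaleC)
  show r: "A * c *\<^sub>C B = c *\<^sub>C (A * B)" for c
    by (rule UP_eqI) (simp add: entry_times mult_scaleC_right infsum_scaleC)
  show "r *\<^sub>R A * B = r *\<^sub>R (A * B)" by (simp add: scaleR_scaleC l)
  show "A * r *\<^sub>R B = r *\<^sub>R (A * B)" by (simp add: scaleR_scaleC r)
  have s: "(\<lambda>p. norm (entry (A * B) (fst p) (snd p))) summable_on UNIV"
    by (rule entry_summable')
  have "norm (A * B) \<le> (\<Sum>\<^sub>\<infinity>p. \<Sum>\<^sub>\<infinity>k. norm (entry A (fst p) k) * norm (entry B k (snd p)))"
    unfolding norm_UP_eq
    by (rule infsum_mono[OF s UP_mult_double(1)]) (simp add: entry_times UP_mult_norm_entry)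
  also have "\<dots> \<le> norm A * norm B" by (rule UP_mult_double)
  finally show "norm (A * B) \<le> norm A * norm B" .
qed

end

end

theory Submission
  imports Defs
begin

text \<open>
  Suppose that \<open>i < j\<close>, and write \<open>E\<^sub>i\<^sub>j\<close> for the matrix with the unit of \<open>A\<close> at position
  \<open>(i, j)\<close> and zeros elsewhere. Every tensor \<open>m\<close> that commutes with \<open>E\<^sub>i\<^sub>j\<close> has a product whose
  \<open>(j, j)\<close> entry vanishes. Indeed, by triangularity this entry is the image of \<open>m\<close> under the map
  \<open>x \<otimes> y \<mapsto> x\<^sub>j\<^sub>j y\<^sub>j\<^sub>j\<close>. Let \<open>S\<close> be the bounded linear map \<open>x \<otimes> y \<mapsto> x\<^sub>i\<^sub>j y\<^sub>j\<^sub>j\<close>. Multiplication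
  by \<open>E\<^sub>i\<^sub>j\<close> from the left moves row \<open>j\<close> to row \<open>i\<close>, so the entry equals \<open>S (E\<^sub>i\<^sub>j \<cdot> m)\<close>, whereas
  \<open>S (m \<cdot> E\<^sub>i\<^sub>j)\<close> involves only the entries \<open>y\<^sub>j\<^sub>i\<close>, which are zero since \<open>j > i\<close>
  (\<open>entry_tensor_prod_eq_0\<close>). Hence a net of commuting tensors cannot satisfy
  \<open>\<pi>(m) E\<^sub>j\<^sub>j \<rightarrow> E\<^sub>j\<^sub>j\<close>, unless the unit of \<open>A\<close> is zero, and the existence of a character excludes
  this. So the index set of a pseudo-contractible \<open>UP(I, A)\<close> is a singleton.

  The rest is the fact that pseudo-contractibility passes to the image of a surjective bounded
  homomorphism (\<open>pseudo_contractible_surj\<close>), because the homomorphism carries the net along. Taking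
  a diagonal entry is such a map from \<open>UP(I, A)\<close> onto \<open>A\<close>, for every \<open>I\<close>; if \<open>I\<close> is a singleton,
  the embedding of \<open>A\<close> at the only diagonal position is such a map onto \<open>UP(I, A)\<close>.
\<close>

section \<open>Surjective homomorphisms\<close>

lemma bounded_clinear_compose:
  assumes "bounded_clinear f" "bounded_clinear g"
  shows "bounded_clinear (\<lambda>x. f (g x))"
proof -
  have "bounded_linear (\<lambda>x. f (g x))"
    by (rule bounded_linear_compose[OF assms[THEN bounded_clinear_imp_bounded_linear]])
  then obtain K where "\<And>x. norm (f (g x)) \<le> norm x * K"
    using bounded_linear.bounded by blast
  then have "\<exists>K. \<forall>x. norm (f (g x)) \<le> K * norm x"
    by (metis mult.commute)
  then show ?thesis
    using assms by (simp add: bounded_clinear_def clinear_def)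
qed

text \<open>
  If \<open>(m\<^sub>d)\<close> is a net for the source, then \<open>((h \<otimes> h) m\<^sub>d)\<close> is one for the target: it commutes with
  \<open>h a\<close> for every \<open>a\<close>, and its products are \<open>h (\<pi> m\<^sub>d)\<close>. Surjectivity makes \<open>h a\<close> an arbitrary
  element.
\<close>

theorem pseudo_contractible_surj:
  fixes h :: "'a::complex_banach_algebra \<Rightarrow> 'b::complex_banach_algebra"
  assumes pc: "pseudo_contractible TYPE('a)"
    and h: "bounded_clinear h" and mult: "\<And>x y. h (x * y) = h x * h y" and surj: "surj h"
  shows "pseudo_contractible TYPE('b)"
proof -
  obtain D :: "('a set \<times> nat) set" and le and m :: "'a set \<times> nat \<Rightarrow> ('a, 'a) proj_tensor"
    where dir: "directed_set D le"
      and comm: "\<And>d a. d \<in> D \<Longrightarrow> tensor_lmul a (m d) = tensor_rmul (m d) a"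
      and lim: "\<And>a. net_tendsto D le (\<lambda>d. tensor_prod (m d) * a) a"
    using pc unfolding pseudo_contractible_def pseudo_contractible_net_def by blast
  define H where "H = proj_lift (\<lambda>x y. h x \<otimes>\<^sub>p h y)"
  have T: "bounded_cbilinear (\<lambda>x y. h x \<otimes>\<^sub>p h y)"
    by (rule bounded_cbilinear_compose[OF bounded_cbilinear_proj_pure h h])
  have H: "bounded_clinear H" and H_pure: "\<And>x y. H (x \<otimes>\<^sub>p y) = h x \<otimes>\<^sub>p h y"
    unfolding H_def by (rule bounded_clinear_proj_lift[OF T], rule proj_lift_pure[OF T])
  have "(\<lambda>u. H (tensor_lmul a u)) = (\<lambda>u. tensor_lmul (h a) (H u))" for a
    by (rule proj_tensor_eqI[OF bounded_clinear_compose[OF H bounded_clinear_tensor_lmul]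
          bounded_clinear_compose[OF bounded_clinear_tensor_lmul H]])
      (simp add: tensor_lmul_pure H_pure mult)
  then have l: "H (tensor_lmul a u) = tensor_lmul (h a) (H u)" for a u by metis
  have "(\<lambda>u. H (tensor_rmul u a)) = (\<lambda>u. tensor_rmul (H u) (h a))" for a
    by (rule proj_tensor_eqI[OF bounded_clinear_compose[OF H bounded_clinear_tensor_rmul]
          bounded_clinear_compose[OF bounded_clinear_tensor_rmul H]])
      (simp add: tensor_rmul_pure H_pure mult)
  then have r: "H (tensor_rmul u a) = tensor_rmul (H u) (h a)" for a u by metis
  have "(\<lambda>u. tensor_prod (H u)) = (\<lambda>u. h (tensor_prod u))"
    by (rule proj_tensor_eqI[OF bounded_clinear_compose[OF bounded_clinear_tensor_prod H]
          bounded_clinear_compose[OF h bounded_clinear_tensor_prod]])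
      (simp add: tensor_prod_pure H_pure mult)
  then have p: "tensor_prod (H u) = h (tensor_prod u)" for u by metis
  obtain K where K: "K > 0" "\<And>x. norm (h x) \<le> norm x * K"
    using bounded_linear.pos_bounded[OF bounded_clinear_imp_bounded_linear[OF h]] by blast
  have "pseudo_contractible_net D le (\<lambda>d. H (m d))"
    unfolding pseudo_contractible_net_def
  proof (intro conjI ballI allI)
    fix b
    obtain a where b: "b = h a" using surj by (metis surjD)
    show "tensor_lmul b (H (m d)) = tensor_rmul (H (m d)) b" if "d \<in> D" for d
      using comm[OF that, of a] by (simp add: b flip: l r)
    show "net_tendsto D le (\<lambda>d. tensor_prod (H (m d)) * b) b"
      unfolding net_tendsto_def
    proof (intro allI impI)
      fix e :: real assume "e > 0"
      then have "e / K > 0" using K by simp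
      then obtain d0 where d0: "d0 \<in> D"
          "\<And>d. d \<in> D \<Longrightarrow> le d0 d \<Longrightarrow> dist (tensor_prod (m d) * a) a < e / K"
        using lim[of a] unfolding net_tendsto_def by meson
      have "dist (tensor_prod (H (m d)) * b) b < e" if "d \<in> D" "le d0 d" for d
      proof -
        have "dist (tensor_prod (H (m d)) * b) b = norm (h (tensor_prod (m d) * a - a))"
          using h by (simp add: p b dist_norm mult clinear_diff bounded_clinear_def)
        also have "\<dots> \<le> dist (tensor_prod (m d) * a) a * K"
          using K(2) by (simp add: dist_norm)
        also have "\<dots> < e" using d0(2)[OF that] K(1) by (simp add: field_simps)
        finally show ?thesis .
      qed
      then show "\<exists>d0\<in>D. \<forall>d\<in>D. le d0 d \<longrightarrow> dist (tensor_prod (H (m d)) * b) b < e"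
        using d0(1) by blast
    qed
  qed (rule dir)
  then show ?thesis by (rule pseudo_contractibleI)
qed


section \<open>Matrix units and diagonal entries\<close>

lemma infsum_single:
  fixes f :: "'x \<Rightarrow> 'y::{comm_monoid_add, t2_space}"
  assumes "\<And>x. x \<noteq> a \<Longrightarrow> f x = 0"
  shows "infsum f UNIV = f a"
proof -
  have "infsum f UNIV = infsum f {a}"
    by (rule infsum_cong_neutral) (use assms in auto)
  then show ?thesis by simp
qed

text \<open>Below the diagonal there is no room for an entry, and the value is the zero matrix.\<close>

lift_definition matrix_unit :: "'i::linorder \<Rightarrow> 'i \<Rightarrow> 'a::complex_banach_algebra \<Rightarrow> ('i, 'a) UP"
  is "\<lambda>i j a k l. if i \<le> j \<and> k = i \<and> l = j then a else 0"
proof (intro CollectI conjI allI impI)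
  fix i j :: 'i and a :: 'a
  have "(\<lambda>p. norm (if i \<le> j \<and> fst p = i \<and> snd p = j then a else 0)) summable_on UNIV
      \<longleftrightarrow> (\<lambda>p. norm (if i \<le> j \<and> fst p = i \<and> snd p = j then a else 0)) summable_on {(i, j)}"
    by (rule summable_on_cong_neutral) auto
  then show "(\<lambda>(k, l). norm (if i \<le> j \<and> k = i \<and> l = j then a else 0)) summable_on UNIV"
    by (simp add: case_prod_unfold)
qed auto

lemma entry_matrix_unit:
  "entry (matrix_unit i j a) k l = (if i \<le> j \<and> k = i \<and> l = j then a else 0)"
  by transfer simp

lemma norm_matrix_unit: "i \<le> j \<Longrightarrow> norm (matrix_unit i j a) = norm a"
  unfolding norm_UP_eq
  by (subst infsum_single[where a = "(i, j)"]) (auto simp: entry_matrix_unit)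

lemma bounded_clinear_matrix_unit:
  assumes "i \<le> j"
  shows "bounded_clinear (matrix_unit i j)"
  unfolding bounded_clinear_def clinear_def
  by (auto intro!: UP_eqI exI[of _ 1] simp: entry_matrix_unit norm_matrix_unit assms)

lemma bounded_clinear_entry: "bounded_clinear (\<lambda>x. entry x i j)"
  unfolding bounded_clinear_def clinear_def
  by (auto intro!: exI[of _ 1] norm_entry_le)

lemma entry_matrix_unit_mult:
  assumes "i \<le> j"
  shows "entry (matrix_unit i j a * x) i l = a * entry x j l"
  unfolding entry_times
  by (subst infsum_single[where a = j]) (auto simp: entry_matrix_unit assms)

lemma entry_mult_matrix_unit:
  assumes "i \<le> j"
  shows "entry (x * matrix_unit i j a) k j = entry x k i * a"
  unfolding entry_times
  by (subst infsum_single[where a = i]) (auto simp: entry_matrix_unit assms)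

lemma entry_mult_diag: "entry (x * y) j j = entry x j j * entry y j j"
  unfolding entry_times
proof (rule infsum_single)
  fix k assume "k \<noteq> j"
  then have "\<not> j \<le> k \<or> \<not> k \<le> j" by auto
  then show "entry x j k * entry y k j = 0"
    by (metis entry_eq_0 mult_zero_left mult_zero_right)
qed

lemma matrix_unit_diag_mult: "matrix_unit i i (a * b) = matrix_unit i i a * matrix_unit i i b"
proof (rule UP_eqI)
  fix k l
  show "entry (matrix_unit i i (a * b)) k l = entry (matrix_unit i i a * matrix_unit i i b) k l"
    unfolding entry_times
    by (subst infsum_single[where a = i]) (auto simp: entry_matrix_unit)
qed

lemma surj_entry_diag: "surj (\<lambda>x :: ('i::linorder, 'a::complex_banach_algebra) UP. entry x i i)"
  by (rule surjI[of _ "matrix_unit i i"]) (simp add: entry_matrix_unit)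

lemma surj_matrix_unit_singleton:
  assumes "(UNIV :: 'i::linorder set) = {i}"
  shows "surj (matrix_unit i i :: 'a::complex_banach_algebra \<Rightarrow> _)"
proof (rule surjI[of _ "\<lambda>x. entry x i i"], rule UP_eqI)
  fix x :: "('i, 'a) UP" and k l :: 'i
  have "k = i" "l = i" using assms by auto
  then show "entry (matrix_unit i i (entry x i i)) k l = entry x k l"
    by (simp add: entry_matrix_unit)
qed


section \<open>Tensors commuting with an off-diagonal matrix unit\<close>

text \<open>
  Both sides of the commutation relation are evaluated by the map \<open>S\<close> that reads the first factor
  at \<open>(i, j)\<close> and the second at \<open>(j, j)\<close>. Acting from the left, the matrix unit lifts row \<open>j\<close> of the
  first factor to row \<open>i\<close>, which makes \<open>S\<close> see the diagonal entries that form the product. Acting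
  from the right, it fills column \<open>j\<close> of the second factor with column \<open>i\<close>, which is zero in row
  \<open>j\<close>.
\<close>

lemma entry_tensor_prod_eq_0:
  fixes m :: "(('i::linorder, 'a::complex_banach_algebra) UP, ('i, 'a) UP) proj_tensor"
  assumes unit: "\<And>x :: 'a. e * x = x" and ij: "i < j"
    and comm: "tensor_lmul (matrix_unit i j e) m = tensor_rmul m (matrix_unit i j e)"
  shows "entry (tensor_prod m) j j = 0"
proof -
  let ?E = "matrix_unit i j e :: ('i, 'a) UP"
  define S :: "(('i, 'a) UP, ('i, 'a) UP) proj_tensor \<Rightarrow> 'a"
    where "S = proj_lift (\<lambda>x y. entry x i j * entry y j j)"
  have T: "bounded_cbilinear (\<lambda>x y :: ('i, 'a) UP. entry x i j * entry y j j)"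
    by (rule bounded_cbilinear_compose[OF bounded_cbilinear_mult bounded_clinear_entry
          bounded_clinear_entry])
  have S: "bounded_clinear S" and S_pure: "\<And>x y. S (x \<otimes>\<^sub>p y) = entry x i j * entry y j j"
    unfolding S_def by (rule bounded_clinear_proj_lift[OF T], rule proj_lift_pure[OF T])
  have "(\<lambda>u. entry (tensor_prod u) j j) = (\<lambda>u. S (tensor_lmul ?E u))"
    by (rule proj_tensor_eqI[OF
          bounded_clinear_compose[OF bounded_clinear_entry bounded_clinear_tensor_prod]
          bounded_clinear_compose[OF S bounded_clinear_tensor_lmul]])
      (use ij in \<open>simp add: tensor_prod_pure tensor_lmul_pure S_pure entry_mult_diag
        entry_matrix_unit_mult unit\<close>)
  moreover have "(\<lambda>u. S (tensor_rmul u ?E)) = (\<lambda>_. 0)"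
  proof (rule proj_tensor_eqI)
    show "bounded_clinear (\<lambda>u. S (tensor_rmul u ?E))"
      by (rule bounded_clinear_compose[OF S bounded_clinear_tensor_rmul])
    show "bounded_clinear (\<lambda>_ :: (('i, 'a) UP, ('i, 'a) UP) proj_tensor. 0 :: 'a)"
      by (auto simp: bounded_clinear_def clinear_def intro!: exI[of _ 0])
    show "S (tensor_rmul (x \<otimes>\<^sub>p y) ?E) = 0" for x y
      using ij by (simp add: tensor_rmul_pure S_pure entry_mult_matrix_unit entry_eq_0)
  qed
  ultimately show ?thesis using comm by metis
qed

text \<open>
  The defining limit, tested on \<open>E\<^sub>j\<^sub>j\<close> at position \<open>(j, j)\<close>, would bring \<open>0\<close> arbitrarily close to
  the unit.
\<close>

lemma not_pseudo_contractible_UP: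
  fixes i j :: "'i::linorder" and e :: "'a::complex_banach_algebra"
  assumes unit: "\<And>x. e * x = x" and e: "e \<noteq> 0" and ij: "i < j"
  shows "\<not> pseudo_contractible TYPE(('i, 'a) UP)"
proof
  let ?E = "matrix_unit j j e :: ('i, 'a) UP"
  assume "pseudo_contractible TYPE(('i, 'a) UP)"
  then obtain D :: "(('i, 'a) UP set \<times> nat) set" and le
      and m :: "('i, 'a) UP set \<times> nat \<Rightarrow> (('i, 'a) UP, ('i, 'a) UP) proj_tensor"
    where dir: "directed_set D le"
      and comm: "\<And>d a. d \<in> D \<Longrightarrow> tensor_lmul a (m d) = tensor_rmul (m d) a"
      and lim: "\<And>a. net_tendsto D le (\<lambda>d. tensor_prod (m d) * a) a"
    unfolding pseudo_contractible_def pseudo_contractible_net_def by blast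
  have "norm e > 0" using e by simp
  then obtain d where d: "d \<in> D"
      "\<forall>d'\<in>D. le d d' \<longrightarrow> dist (tensor_prod (m d') * ?E) ?E < norm e"
    using lim[of ?E] unfolding net_tendsto_def by blast
  moreover have "le d d" using dir d(1) unfolding directed_set_def by blast
  ultimately have less: "dist (tensor_prod (m d) * ?E) ?E < norm e" by blast
  have "entry (tensor_prod (m d) * ?E) j j = 0"
    using entry_tensor_prod_eq_0[OF unit ij comm[OF d(1)]] by (simp add: entry_mult_diag)
  then have "norm e \<le> dist (tensor_prod (m d) * ?E) ?E"
    using norm_entry_le[of "tensor_prod (m d) * ?E - ?E" j j]
    by (simp add: dist_norm entry_matrix_unit)
  then show False using less by simp
qed


section \<open>Pseudo-contractible triangular matrix algebras\<close>

theorem theorem2p1: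
  assumes unital: "\<exists>e :: 'a::complex_banach_algebra. \<forall>x. e * x = x \<and> x * e = x"
    and characters: "(character_space :: ('a \<Rightarrow> complex) set) \<noteq> {}"
  shows "pseudo_contractible TYPE(('i::linorder, 'a) UP) \<longleftrightarrow>
    (\<exists>i. (UNIV :: 'i set) = {i}) \<and> pseudo_contractible TYPE('a)"
proof
  assume pc: "pseudo_contractible TYPE(('i, 'a) UP)"
  \<comment> \<open>The diagonal position is arbitrary: every diagonal entry is a surjective homomorphism.\<close>
  have A: "pseudo_contractible TYPE('a)"
    using pc
  proof (rule pseudo_contractible_surj[where h = "\<lambda>x. entry x undefined undefined"])
    show "bounded_clinear (\<lambda>x :: ('i, 'a) UP. entry x undefined undefined)"
      by (rule bounded_clinear_entry)
    show "surj (\<lambda>x :: ('i, 'a) UP. entry x undefined undefined)"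
      by (rule surj_entry_diag)
  qed (rule entry_mult_diag)
  obtain e :: 'a where unit: "\<And>x. e * x = x" using unital by blast
  have "e \<noteq> 0"
  proof
    assume "e = 0"
    then have zero: "x = 0" for x :: 'a using unit[of x] by simp
    obtain \<phi> :: "'a \<Rightarrow> complex" where \<phi>: "clinear \<phi>" "\<phi> \<noteq> (\<lambda>_. 0)"
      using characters unfolding character_space_def by blast
    then obtain x where "\<phi> x \<noteq> 0" by blast
    then show False using clinear_zero[OF \<phi>(1)] zero[of x] by simp
  qed
  then have "\<not> i < j" for i j :: 'i
    using not_pseudo_contractible_UP[OF unit] pc by blast
  then have "i = undefined" for i :: 'i
    by (metis linorder_neqE)
  then have "(UNIV :: 'i set) = {undefined}" by blast
  then show "(\<exists>i. (UNIV :: 'i set) = {i}) \<and> pseudo_contractible TYPE('a)"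
    using A by blast
next
  assume "(\<exists>i. (UNIV :: 'i set) = {i}) \<and> pseudo_contractible TYPE('a)"
  then obtain i where pc: "pseudo_contractible TYPE('a)" and i: "(UNIV :: 'i set) = {i}"
    by blast
  show "pseudo_contractible TYPE(('i, 'a) UP)"
    by (rule pseudo_contractible_surj[OF pc bounded_clinear_matrix_unit[OF order_refl]
          matrix_unit_diag_mult surj_matrix_unit_singleton[OF i]])
qed

end
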